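(* Let $R$ be a ring and $\kappa$ an infinite cardinal. Let $F\xrightarrow{f_0}F\xrightarrow{f_1}F\xrightarrow{f_2}\cdots$ be a countable direct system of modules, all equal to a fixed module $F$, with direct limit $N\neq 0$. Let $E=\{\alpha<\kappa^+\mid\mathrm{cf}(\alpha)=\aleph_0\}$, and let $M=M_{\kappa^+}$ and its submodules $M_\alpha$ ($\alpha\le\kappa^+$) be constructed from these data as described in the context. Then: (i) $(M_\alpha\mid\alpha\le\kappa^+)$ is a strictly increasing filtration of $M$. (ii) If $\mathrm{card}(F),\mathrm{card}(R)\le\kappa$, then $M_\alpha$ is a $<\kappa^+$-generated (equivalently, $<\kappa^+$-presented) module for each $\alpha<\kappa^+$. In particular, $M$ is $\kappa^+$-generated (i.e. has a generating set of cardinality $\le\kappa^+$). (iii) Let $\nu<\mu\le\kappa^+$ and assume that $\nu\in E$. Then there exists a module $K\subseteq M_\mu/M_\nu$ such that $M_\mu/M_\nu=M_{\nu+1}/M_\nu\oplus K$ and $M_{\nu+1}/M_\nu\cong N$.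
   Context: Rings are associative with $1$, modules are unital, and "module" means right $R$-module. A filtration of $M$ is an increasing chain of submodules $(M_\alpha\mid\alpha\le\lambda)$ with $M_0=0$, $M_\alpha\subseteq M_{\alpha+1}$ for $\alpha<\lambda$, $M_\lambda=M$, and $M_\alpha=\bigcup_{\beta<\alpha}M_\beta$ for each limit $\alpha\le\lambda$. A module is $<\mu$-generated if it has a generating set of cardinality $<\mu$, and $<\mu$-presented if it has a presentation $0\to K\to F'\to M\to 0$ with $F'$ free of rank $<\mu$ and $K$ $<\mu$-generated. Construction. For each $\nu\in E$ fix a strictly increasing sequence $s_\nu=(s_\nu(i)\mid i<\omega)$ of ordinals less than $\nu$ with $\sup_{i<\omega}s_\nu(i)=\nu$, chosen so that $s_\nu(i)=\tau_{\nu,i}+i+1$ where each $\tau_{\nu,i}$ is a limit ordinal or $0$. (Hence $s_\mu(i)=s_\nu(j)$ implies $i=j$, and $s_\nu(i)\notin E$.) For $\alpha<\kappa^+$ put $F_\alpha=F$ if $\alpha\notin E$, and $F_\alpha=\bigoplus_{i<\omega}F_{\alpha,i}$ with each $F_{\alpha,i}=F$ if $\alpha\in E$. Let $P=\bigoplus_{\alpha<\kappa^+}F_\alpha$, with the $F_\alpha$ regarded as submodules of $P$. For $\alpha\in\kappa^+\setminus E$ let $1_\alpha$ be the endomorphism of $P$ that is the identity on $F_\alpha$ and zero on $F_\beta$ for $\beta\ne\alpha$. In the definition of $g_{\alpha i}$ below, $1_{s_\alpha(i)}$ denotes the map which, on $F_{\alpha,i}$, is the canonical identification $F_{\alpha,i}=F=F_{s_\alpha(i)}$,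 so that, explicitly, for $\alpha\in E$ and $i<\omega$ the submodule $\mathrm{Im}(g_{\alpha i})$ of $P$ is $$\{\,x_{(s_\alpha(i))}-x_{(\alpha,i)}+f_i(x)_{(\alpha,i+1)}\mid x\in F\,\},$$ where $x_{(\beta)}$ denotes the copy of $x$ in $F_\beta$ ($\beta\notin E$) and $x_{(\alpha,i)}$ the copy of $x$ in $F_{\alpha,i}$; that is, $g_{\alpha i}=1_{s_\alpha(i)}-1_{\alpha,i}+f_{\alpha,i}$, where $1_{\alpha,i}$ is the identity on $F_{\alpha,i}$, $f_{\alpha,i}$ maps $F_{\alpha,i}$ to $F_{\alpha,i+1}$ via $f_i$. These images are independent submodules of $P$. Let $G_\alpha=\bigoplus_{i<\omega}\mathrm{Im}(g_{\alpha i})$ for $\alpha\in E$, $G=\bigoplus_{\alpha\in E}G_\alpha$, and $M=M_{\kappa^+}=P/G$. For each $\alpha\le\kappa^+$ let $M_\alpha=\bigl(\bigoplus_{\beta<\alpha}F_\beta+G\bigr)/G$. *)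

theory Defs
  imports "HOL-Algebra.Module" "HOL-Algebra.AbelCoset"
begin

unbundle cardinal_syntax

section \<open>Ordinals and cardinals as elements of a well-ordered type\<close>

text \<open>
  An element \<open>\<alpha>\<close> of a well-ordered type stands for the ordinal whose set of predecessors is
  \<open>{..<\<alpha>}\<close>; cardinals are the initial ordinals. A type that contains an ordinal \<open>\<mu>\<close> contains every
  smaller ordinal as well.
\<close>

definition ozero :: "'o::wellorder" where
  "ozero = (LEAST \<alpha>. True)"

text \<open>Only meaningful when \<open>\<alpha>\<close> is not the greatest element of the type.\<close>

definition osuc :: "'o::wellorder \<Rightarrow> 'o" where
  "osuc \<alpha> = (LEAST \<beta>. \<alpha> < \<beta>)"

definition limit_ordinal :: "'o::wellorder \<Rightarrow> bool" where
  "limit_ordinal \<alpha> \<longleftrightarrow> \<alpha> \<noteq> ozero \<and> (\<forall>\<beta><\<alpha>. osuc \<beta> < \<alpha>)"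

definition is_cardinal :: "'o::wellorder \<Rightarrow> bool" where
  "is_cardinal \<mu> \<longleftrightarrow> (\<forall>\<alpha><\<mu>. |{..<\<alpha>}| <o |{..<\<mu>}| )"

definition infinite_cardinal :: "'o::wellorder \<Rightarrow> bool" where
  "infinite_cardinal \<kappa> \<longleftrightarrow> is_cardinal \<kappa> \<and> infinite {..<\<kappa>}"

definition successor_cardinal :: "'o::wellorder \<Rightarrow> 'o \<Rightarrow> bool" where
  "successor_cardinal \<kappa> \<kappa>p \<longleftrightarrow> is_cardinal \<kappa>p \<and> |{..<\<kappa>p}| =o cardSuc |{..<\<kappa>}|"

text \<open>Cofinality in the weak sense, so that a successor ordinal has cofinality one.\<close>

definition cofinal_in :: "'o::wellorder set \<Rightarrow> 'o \<Rightarrow> bool" where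
  "cofinal_in A \<alpha> \<longleftrightarrow> A \<subseteq> {..<\<alpha>} \<and> (\<forall>\<beta><\<alpha>. \<exists>a\<in>A. \<beta> \<le> a)"

definition has_cofinality :: "'o::wellorder \<Rightarrow> 'c rel \<Rightarrow> bool" where
  "has_cofinality \<alpha> r \<longleftrightarrow>
     (\<exists>A. cofinal_in A \<alpha> \<and> |A| =o r) \<and> (\<forall>A. cofinal_in A \<alpha> \<longrightarrow> r \<le>o |A| )"


section \<open>Right modules\<close>

text \<open>
  The record type of HOL-Algebra is used for right modules over a not necessarily commutative
  ring: \<open>a \<odot>\<^bsub>M\<^esub> x\<close> is the element written \<open>x a\<close> in right-module notation. The fields
  \<open>mult\<close> and \<open>one\<close> of a module record play no role.
\<close>

locale right_module = R?: ring R + M?: abelian_group M for R (structure) and M (structure) +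
  assumes smult_closed:
      "\<lbrakk>a \<in> carrier R; x \<in> carrier M\<rbrakk> \<Longrightarrow> a \<odot>\<^bsub>M\<^esub> x \<in> carrier M"
    and smult_l_distr:
      "\<lbrakk>a \<in> carrier R; b \<in> carrier R; x \<in> carrier M\<rbrakk> \<Longrightarrow>
        (a \<oplus>\<^bsub>R\<^esub> b) \<odot>\<^bsub>M\<^esub> x = a \<odot>\<^bsub>M\<^esub> x \<oplus>\<^bsub>M\<^esub> b \<odot>\<^bsub>M\<^esub> x"
    and smult_r_distr:
      "\<lbrakk>a \<in> carrier R; x \<in> carrier M; y \<in> carrier M\<rbrakk> \<Longrightarrow>
        a \<odot>\<^bsub>M\<^esub> (x \<oplus>\<^bsub>M\<^esub> y) = a \<odot>\<^bsub>M\<^esub> x \<oplus>\<^bsub>M\<^esub> a \<odot>\<^bsub>M\<^esub> y"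
    and smult_assoc_right:
      "\<lbrakk>a \<in> carrier R; b \<in> carrier R; x \<in> carrier M\<rbrakk> \<Longrightarrow>
        (a \<otimes>\<^bsub>R\<^esub> b) \<odot>\<^bsub>M\<^esub> x = b \<odot>\<^bsub>M\<^esub> (a \<odot>\<^bsub>M\<^esub> x)"
    and smult_one:
      "x \<in> carrier M \<Longrightarrow> \<one>\<^bsub>R\<^esub> \<odot>\<^bsub>M\<^esub> x = x"

definition mod_hom ::
    "('r, 'x) ring_scheme \<Rightarrow> ('r, 'a, 'y) module_scheme \<Rightarrow> ('r, 'b, 'z) module_scheme \<Rightarrow> ('a \<Rightarrow> 'b) set"
  where
  "mod_hom R A B = {\<phi>. \<phi> \<in> carrier A \<rightarrow> carrier B
     \<and> (\<forall>x\<in>carrier A. \<forall>y\<in>carrier A. \<phi> (x \<oplus>\<^bsub>A\<^esub> y) = \<phi> x \<oplus>\<^bsub>B\<^esub> \<phi> y)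
     \<and> (\<forall>a\<in>carrier R. \<forall>x\<in>carrier A. \<phi> (a \<odot>\<^bsub>A\<^esub> x) = a \<odot>\<^bsub>B\<^esub> \<phi> x)}"

definition mod_isomorphic ::
    "('r, 'x) ring_scheme \<Rightarrow> ('r, 'a, 'y) module_scheme \<Rightarrow> ('r, 'b, 'z) module_scheme \<Rightarrow> bool"
  where
  "mod_isomorphic R A B \<longleftrightarrow> (\<exists>\<phi>\<in>mod_hom R A B. bij_betw \<phi> (carrier A) (carrier B))"

text \<open>A submodule \<open>H\<close> of \<open>M\<close>, regarded as a module, is \<open>M\<lparr>carrier := H\<rparr>\<close>.\<close>

definition mod_span :: "('r, 'x) ring_scheme \<Rightarrow> ('r, 'a, 'y) module_scheme \<Rightarrow> 'a set \<Rightarrow> 'a set" where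
  "mod_span R M A = \<Inter>{H. submodule H R M \<and> A \<subseteq> H}"

definition quot_module :: "('r, 'a, 'y) module_scheme \<Rightarrow> 'a set \<Rightarrow> ('r, 'a set) module" where
  "quot_module M H =
    \<lparr>carrier = a_rcosets\<^bsub>M\<^esub> H, mult = (\<lambda>_ _. undefined), one = undefined,
     zero = H, add = (<+>\<^bsub>M\<^esub>), smult = (\<lambda>a X. \<Union>x\<in>X. H +>\<^bsub>M\<^esub> (a \<odot>\<^bsub>M\<^esub> x))\<rparr>"

definition internal_direct_sum ::
    "('r, 'x) ring_scheme \<Rightarrow> ('r, 'a, 'y) module_scheme \<Rightarrow> 'a set \<Rightarrow> 'a set \<Rightarrow> bool" where
  "internal_direct_sum R M A B \<longleftrightarrow> submodule A R M \<and> submodule B R M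
     \<and> A <+>\<^bsub>M\<^esub> B = carrier M \<and> A \<inter> B = {\<zero>\<^bsub>M\<^esub>}"

text \<open>
  The direct sum of copies of \<open>F\<close> indexed by \<open>J\<close>: finitely supported functions, which are
  \<open>0\<close> off \<open>J\<close>. With this convention the direct sum over a subset of \<open>J\<close> is literally
  a submodule of the direct sum over \<open>J\<close>.
\<close>

definition dsum_copies :: "'j set \<Rightarrow> ('r, 'f, 'y) module_scheme \<Rightarrow> ('r, 'j \<Rightarrow> 'f) module" where
  "dsum_copies J F =
    \<lparr>carrier = {x. (\<forall>j\<in>J. x j \<in> carrier F) \<and> (\<forall>j. j \<notin> J \<longrightarrow> x j = \<zero>\<^bsub>F\<^esub>)
                 \<and> finite {j. x j \<noteq> \<zero>\<^bsub>F\<^esub>}},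
     mult = (\<lambda>_ _. undefined), one = undefined,
     zero = (\<lambda>j. \<zero>\<^bsub>F\<^esub>), add = (\<lambda>x y j. x j \<oplus>\<^bsub>F\<^esub> y j), smult = (\<lambda>a x j. a \<odot>\<^bsub>F\<^esub> x j)\<rparr>"

definition copy_at :: "('r, 'f, 'y) module_scheme \<Rightarrow> 'j \<Rightarrow> 'f \<Rightarrow> 'j \<Rightarrow> 'f" where
  "copy_at F j x = (\<lambda>k. if k = j then x else \<zero>\<^bsub>F\<^esub>)"

definition regular_module :: "('r, 'x) ring_scheme \<Rightarrow> ('r, 'r) module" where
  "regular_module R =
    \<lparr>carrier = carrier R, mult = (\<lambda>_ _. undefined), one = undefined,
     zero = \<zero>\<^bsub>R\<^esub>, add = (\<oplus>\<^bsub>R\<^esub>), smult = (\<lambda>a x. x \<otimes>\<^bsub>R\<^esub> a)\<rparr>"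


section \<open>Generation, presentation, filtrations\<close>

definition lt_generated ::
    "('r, 'x) ring_scheme \<Rightarrow> 'o::wellorder \<Rightarrow> ('r, 'a, 'y) module_scheme \<Rightarrow> bool" where
  "lt_generated R \<mu> M \<longleftrightarrow>
     (\<exists>A\<subseteq>carrier M. |A| <o |{..<\<mu>}| \<and> mod_span R M A = carrier M)"

definition le_generated ::
    "('r, 'x) ring_scheme \<Rightarrow> 'o::wellorder \<Rightarrow> ('r, 'a, 'y) module_scheme \<Rightarrow> bool" where
  "le_generated R \<mu> M \<longleftrightarrow>
     (\<exists>A\<subseteq>carrier M. |A| \<le>o |{..<\<mu>}| \<and> mod_span R M A = carrier M)"

text \<open>
  A free module of rank less than \<open>\<mu>\<close> is, up to isomorphism, a direct sum of copies of \<open>R\<close>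
  indexed by a set \<open>X\<close> of ordinals below \<open>\<mu>\<close> with fewer than \<open>\<mu>\<close> elements.
\<close>

definition lt_presented ::
    "('r, 'x) ring_scheme \<Rightarrow> 'o::wellorder \<Rightarrow> ('r, 'a, 'y) module_scheme \<Rightarrow> bool" where
  "lt_presented R \<mu> M \<longleftrightarrow>
     (\<exists>X\<subseteq>{..<\<mu>}. |X| <o |{..<\<mu>}| \<and>
        (let F' = dsum_copies X (regular_module R) in
         \<exists>\<phi>\<in>mod_hom R F' M. \<phi> ` carrier F' = carrier M
           \<and> lt_generated R \<mu> (F'\<lparr>carrier := a_kernel F' M \<phi>\<rparr>)))"

definition filtration ::
    "('r, 'x) ring_scheme \<Rightarrow> ('r, 'a, 'y) module_scheme \<Rightarrow> 'o::wellorder \<Rightarrow> ('o \<Rightarrow> 'a set) \<Rightarrow> bool" where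
  "filtration R M l H \<longleftrightarrow>
     (\<forall>\<alpha>\<le>l. submodule (H \<alpha>) R M)
     \<and> H ozero = {\<zero>\<^bsub>M\<^esub>}
     \<and> (\<forall>\<alpha><l. H \<alpha> \<subseteq> H (osuc \<alpha>))
     \<and> H l = carrier M
     \<and> (\<forall>\<alpha>\<le>l. limit_ordinal \<alpha> \<longrightarrow> H \<alpha> = (\<Union>\<beta><\<alpha>. H \<beta>))"

definition strictly_increasing_filtration ::
    "('r, 'x) ring_scheme \<Rightarrow> ('r, 'a, 'y) module_scheme \<Rightarrow> 'o::wellorder \<Rightarrow> ('o \<Rightarrow> 'a set) \<Rightarrow> bool" where
  "strictly_increasing_filtration R M l H \<longleftrightarrow>
     filtration R M l H \<and> (\<forall>\<alpha> \<beta>. \<alpha> < \<beta> \<and> \<beta> \<le> l \<longrightarrow> H \<alpha> \<subset> H \<beta>)"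


section \<open>Direct limits of countable systems\<close>

text \<open>\<open>transition f i n\<close> is the composite map from the \<open>i\<close>-th to the \<open>(i+n)\<close>-th term.\<close>

primrec transition :: "(nat \<Rightarrow> 'f \<Rightarrow> 'f) \<Rightarrow> nat \<Rightarrow> nat \<Rightarrow> 'f \<Rightarrow> 'f" where
  "transition f i 0 = id"
| "transition f i (Suc n) = f (i + n) \<circ> transition f i n"

text \<open>
  The standard construction: the direct sum of the terms of the system modulo the submodule
  generated by the elements \<open>x\<^sub>i - (f\<^sub>i\<^sub>j x)\<^sub>j\<close> for \<open>i \<le> j\<close>.
\<close>

definition direct_limit ::
    "('r, 'x) ring_scheme \<Rightarrow> ('r, 'f, 'y) module_scheme \<Rightarrow> (nat \<Rightarrow> 'f \<Rightarrow> 'f)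
      \<Rightarrow> ('r, (nat \<Rightarrow> 'f) set) module" where
  "direct_limit R F f =
    (let S = dsum_copies UNIV F in
     quot_module S
       (mod_span R S {copy_at F i x \<ominus>\<^bsub>S\<^esub> copy_at F (i + n) (transition f i n x) | i n x. x \<in> carrier F}))"


section \<open>The construction\<close>

definition cof_omega :: "'o::wellorder \<Rightarrow> 'o set" where
  "cof_omega \<kappa>p = {\<alpha>. \<alpha> < \<kappa>p \<and> has_cofinality \<alpha> natLeq}"

text \<open>\<open>(osuc ^^ Suc i) \<tau>\<close> is the ordinal \<open>\<tau> + i + 1\<close>.\<close>

definition ladder_system :: "'o::wellorder \<Rightarrow> ('o \<Rightarrow> nat \<Rightarrow> 'o) \<Rightarrow> bool" where
  "ladder_system \<kappa>p s \<longleftrightarrow> (\<forall>\<nu>\<in>cof_omega \<kappa>p.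
     strict_mono (s \<nu>) \<and> (\<forall>i. s \<nu> i < \<nu>)
     \<and> (\<forall>\<beta>. (\<forall>i. s \<nu> i \<le> \<beta>) \<longrightarrow> \<nu> \<le> \<beta>)
     \<and> (\<forall>i. \<exists>\<tau><\<nu>. (limit_ordinal \<tau> \<or> \<tau> = ozero) \<and> s \<nu> i = (osuc ^^ Suc i) \<tau>))"

text \<open>
  \<open>P\<close> is a direct sum of copies of \<open>F\<close>, one for each slot: \<open>Single \<alpha>\<close> is the
  summand \<open>F\<^sub>\<alpha>\<close> for \<open>\<alpha> \<notin> E\<close>, and \<open>Double \<alpha> i\<close> is the \<open>i\<close>-th summand of
  \<open>F\<^sub>\<alpha>\<close> for \<open>\<alpha> \<in> E\<close>.
\<close>

datatype 'o slot = Single 'o | Double 'o nat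

primrec slot_ord :: "'o slot \<Rightarrow> 'o" where
  "slot_ord (Single \<alpha>) = \<alpha>"
| "slot_ord (Double \<alpha> i) = \<alpha>"

definition slots :: "'o::wellorder \<Rightarrow> 'o slot set" where
  "slots \<kappa>p = {Single \<alpha> | \<alpha>. \<alpha> < \<kappa>p \<and> \<alpha> \<notin> cof_omega \<kappa>p} \<union> {Double \<alpha> i | \<alpha> i. \<alpha> \<in> cof_omega \<kappa>p}"

definition P_mod :: "('r, 'f, 'y) module_scheme \<Rightarrow> 'o::wellorder \<Rightarrow> ('r, 'o slot \<Rightarrow> 'f) module" where
  "P_mod F \<kappa>p = dsum_copies (slots \<kappa>p) F"

text \<open>The submodule \<open>\<Oplus>\<^bsub>\<beta><\<alpha>\<^esub> F\<^sub>\<beta>\<close> of \<open>P\<close>.\<close>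

definition P_below :: "('r, 'f, 'y) module_scheme \<Rightarrow> 'o::wellorder \<Rightarrow> 'o \<Rightarrow> ('o slot \<Rightarrow> 'f) set" where
  "P_below F \<kappa>p \<alpha> = carrier (dsum_copies {j \<in> slots \<kappa>p. slot_ord j < \<alpha>} F)"

definition Im_g ::
    "('r, 'f, 'y) module_scheme \<Rightarrow> (nat \<Rightarrow> 'f \<Rightarrow> 'f) \<Rightarrow> 'o::wellorder \<Rightarrow> ('o \<Rightarrow> nat \<Rightarrow> 'o)
      \<Rightarrow> 'o \<Rightarrow> nat \<Rightarrow> ('o slot \<Rightarrow> 'f) set" where
  "Im_g F f \<kappa>p s \<alpha> i =
    (let P = P_mod F \<kappa>p in
     {copy_at F (Single (s \<alpha> i)) x \<ominus>\<^bsub>P\<^esub> copy_at F (Double \<alpha> i) x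
        \<oplus>\<^bsub>P\<^esub> copy_at F (Double \<alpha> (i + 1)) (f i x) | x. x \<in> carrier F})"

text \<open>
  The submodules \<open>Im_g\<close> are independent, so the internal direct sums defining \<open>G\<^sub>\<alpha>\<close> and \<open>G\<close>
  are the submodules generated by the respective unions.
\<close>

definition G_at ::
    "('r, 'x) ring_scheme \<Rightarrow> ('r, 'f, 'y) module_scheme \<Rightarrow> (nat \<Rightarrow> 'f \<Rightarrow> 'f) \<Rightarrow> 'o::wellorder
      \<Rightarrow> ('o \<Rightarrow> nat \<Rightarrow> 'o) \<Rightarrow> 'o \<Rightarrow> ('o slot \<Rightarrow> 'f) set" where
  "G_at R F f \<kappa>p s \<alpha> = mod_span R (P_mod F \<kappa>p) (\<Union>i. Im_g F f \<kappa>p s \<alpha> i)"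

definition G_sub ::
    "('r, 'x) ring_scheme \<Rightarrow> ('r, 'f, 'y) module_scheme \<Rightarrow> (nat \<Rightarrow> 'f \<Rightarrow> 'f) \<Rightarrow> 'o::wellorder
      \<Rightarrow> ('o \<Rightarrow> nat \<Rightarrow> 'o) \<Rightarrow> ('o slot \<Rightarrow> 'f) set" where
  "G_sub R F f \<kappa>p s = mod_span R (P_mod F \<kappa>p) (\<Union>\<alpha>\<in>cof_omega \<kappa>p. G_at R F f \<kappa>p s \<alpha>)"

definition M_mod ::
    "('r, 'x) ring_scheme \<Rightarrow> ('r, 'f, 'y) module_scheme \<Rightarrow> (nat \<Rightarrow> 'f \<Rightarrow> 'f) \<Rightarrow> 'o::wellorder
      \<Rightarrow> ('o \<Rightarrow> nat \<Rightarrow> 'o) \<Rightarrow> ('r, ('o slot \<Rightarrow> 'f) set) module" where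
  "M_mod R F f \<kappa>p s = quot_module (P_mod F \<kappa>p) (G_sub R F f \<kappa>p s)"

definition M_sub ::
    "('r, 'x) ring_scheme \<Rightarrow> ('r, 'f, 'y) module_scheme \<Rightarrow> (nat \<Rightarrow> 'f \<Rightarrow> 'f) \<Rightarrow> 'o::wellorder
      \<Rightarrow> ('o \<Rightarrow> nat \<Rightarrow> 'o) \<Rightarrow> 'o \<Rightarrow> ('o slot \<Rightarrow> 'f) set set" where
  "M_sub R F f \<kappa>p s \<alpha> =
    (let P = P_mod F \<kappa>p; G = G_sub R F f \<kappa>p s in
     carrier (quot_module (P\<lparr>carrier := P_below F \<kappa>p \<alpha> <+>\<^bsub>P\<^esub> G\<rparr>) G))"

text \<open>
  The module \<open>M\<^sub>\<mu>/M\<^sub>\<nu>\<close> for \<open>\<nu> \<le> \<mu>\<close>. For \<open>\<nu> \<le> \<mu> \<le> \<mu>'\<close> the carrier of \<open>M\<^sub>\<mu>/M\<^sub>\<nu>\<close> is literally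
  a subset of that of \<open>M\<^bsub>\<mu>'\<^esub>/M\<^sub>\<nu>\<close>.
\<close>

definition M_factor ::
    "('r, 'x) ring_scheme \<Rightarrow> ('r, 'f, 'y) module_scheme \<Rightarrow> (nat \<Rightarrow> 'f \<Rightarrow> 'f) \<Rightarrow> 'o::wellorder
      \<Rightarrow> ('o \<Rightarrow> nat \<Rightarrow> 'o) \<Rightarrow> 'o \<Rightarrow> 'o \<Rightarrow> ('r, ('o slot \<Rightarrow> 'f) set set) module" where
  "M_factor R F f \<kappa>p s \<mu> \<nu> =
     quot_module ((M_mod R F f \<kappa>p s)\<lparr>carrier := M_sub R F f \<kappa>p s \<mu>\<rparr>) (M_sub R F f \<kappa>p s \<nu>)"

end

theory Submission
  imports Defs
begin

text \<open>
  Write \<open>U\<^sub>\<alpha> = \<Oplus>\<^bsub>\<beta><\<alpha>\<^esub> F\<^sub>\<beta> + G\<close>, so that \<open>M\<^sub>\<alpha> = U\<^sub>\<alpha>/G\<close>. Membership in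
  \<open>U\<^sub>\<alpha>\<close> is decided by homomorphisms out of \<open>P\<close> that kill \<open>F\<^sub>\<beta>\<close> for \<open>\<beta> < \<alpha>\<close> and all the
  generators \<open>x\<^bsub>(s\<^sub>\<nu>(i))\<^esub> - x\<^bsub>(\<nu>,i)\<^esub> + f\<^sub>i(x)\<^bsub>(\<nu>,i+1)\<^esub>\<close> of \<open>G\<close>.

  For \<open>\<nu> \<in> E\<close>, project \<open>P\<close> to its summand \<open>F\<^sub>\<nu> = \<Oplus>\<^sub>i F\<close> and then to the direct limit \<open>N\<close>. Since
  \<open>s\<^sub>\<mu>(i) \<notin> E\<close>, the projection to \<open>F\<^sub>\<nu>\<close> kills the generators that belong to \<open>\<mu> \<noteq> \<nu>\<close>, and it sends those
  that belong to \<open>\<nu>\<close> to negatives of defining relations of \<open>N\<close>. So it kills \<open>U\<^sub>\<nu>\<close> (\<open>layer_U\<close>).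
  Conversely, modulo \<open>U\<^sub>\<nu>\<close> the generators belonging to \<open>\<nu>\<close> identify
  \<open>x\<^bsub>(\<nu>,i)\<^esub>\<close> with \<open>f\<^sub>i(x)\<^bsub>(\<nu>,i+1)\<^esub>\<close>, because \<open>s\<^sub>\<nu>(i) < \<nu>\<close>; hence an element of
  \<open>\<Oplus>\<^bsub>\<beta>\<le>\<nu>\<^esub> F\<^sub>\<beta>\<close> that vanishes in \<open>N\<close> lies in \<open>U\<^sub>\<nu>\<close> (\<open>mem_U_if_layer\<close>). The induced map
  \<open>M/M\<^sub>\<nu> \<rightarrow> N\<close> is therefore bijective on \<open>M\<^bsub>\<nu>+1\<^esub>/M\<^sub>\<nu>\<close> (\<open>theta_bij\<close>). That is the
  isomorphism of the third part of the theorem, and on every \<open>M\<^sub>\<mu>/M\<^sub>\<nu>\<close> the kernel of the map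
  is a complement of \<open>M\<^bsub>\<nu>+1\<^esub>/M\<^sub>\<nu>\<close>.

  Strictness at \<open>\<nu> \<in> E\<close> is the same statement together with \<open>N \<noteq> 0\<close>. At \<open>\<alpha> \<notin> E\<close> one needs a
  homomorphism \<open>P \<rightarrow> F\<close> that kills \<open>U\<^sub>\<alpha>\<close> and is the identity on \<open>F\<^sub>\<alpha>\<close>. Let it be \<open>0\<close> on
  \<open>F\<^sub>\<beta>\<close> for all other \<open>\<beta> \<notin> E\<close>. If \<open>s\<^sub>\<nu>(k) = \<alpha>\<close>, let it be \<open>0\<close> on \<open>F\<^bsub>\<nu>,i\<^esub>\<close> for \<open>i > k\<close>; the generators
  then force it to be the identity on \<open>F\<^bsub>\<nu>,k\<^esub>\<close> and, by descending induction, the transition map from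
  \<open>i\<close> to \<open>k\<close> on \<open>F\<^bsub>\<nu>,i\<^esub>\<close> for \<open>i < k\<close>. If the ladder at \<open>\<nu>\<close> avoids \<open>\<alpha>\<close>, it may be \<open>0\<close> on all of
  \<open>F\<^sub>\<nu>\<close> (\<open>chase\<close>, \<open>collapse_U\<close>). The rest of the filtration property is inherited from
  \<open>\<Oplus>\<^bsub>\<beta><\<alpha>\<^esub> F\<^sub>\<beta>\<close>, whose elements have finite support.

  For the second part it is enough to count: if \<open>|F| \<le> \<kappa>\<close> and \<open>\<alpha> < \<kappa>\<^sup>+\<close>, then \<open>M\<^sub>\<alpha>\<close> has
  at most \<open>\<kappa>\<close> elements, and a module over a ring with at most \<open>\<kappa>\<close> elements that is
  itself of size at most \<open>\<kappa>\<close> is presented by \<open>\<kappa>\<close> generators and \<open>\<kappa>\<close> relations.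
\<close>


section \<open>Submodules, homomorphisms and quotients of right modules\<close>

context right_module
begin

lemma smult_l_null: assumes "x \<in> carrier M" shows "\<zero>\<^bsub>R\<^esub> \<odot>\<^bsub>M\<^esub> x = \<zero>\<^bsub>M\<^esub>"
proof -
  have "\<zero>\<^bsub>R\<^esub> \<odot>\<^bsub>M\<^esub> x \<oplus>\<^bsub>M\<^esub> \<zero>\<^bsub>R\<^esub> \<odot>\<^bsub>M\<^esub> x = \<zero>\<^bsub>R\<^esub> \<odot>\<^bsub>M\<^esub> x"
    using smult_l_distr[of "\<zero>\<^bsub>R\<^esub>" "\<zero>\<^bsub>R\<^esub>" x] assms by simp
  then show ?thesis using assms smult_closed[of "\<zero>\<^bsub>R\<^esub>" x] by (simp add: M.add.l_cancel_one')
qed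

lemma smult_r_null: assumes "a \<in> carrier R" shows "a \<odot>\<^bsub>M\<^esub> \<zero>\<^bsub>M\<^esub> = \<zero>\<^bsub>M\<^esub>"
proof -
  have "a \<odot>\<^bsub>M\<^esub> \<zero>\<^bsub>M\<^esub> \<oplus>\<^bsub>M\<^esub> a \<odot>\<^bsub>M\<^esub> \<zero>\<^bsub>M\<^esub> = a \<odot>\<^bsub>M\<^esub> \<zero>\<^bsub>M\<^esub>"
    using smult_r_distr[of a "\<zero>\<^bsub>M\<^esub>" "\<zero>\<^bsub>M\<^esub>"] assms by simp
  then show ?thesis using assms smult_closed[of a "\<zero>\<^bsub>M\<^esub>"] by (simp add: M.add.l_cancel_one')
qed

lemma smult_minus_one: assumes "x \<in> carrier M" shows "(\<ominus>\<^bsub>R\<^esub> \<one>\<^bsub>R\<^esub>) \<odot>\<^bsub>M\<^esub> x = \<ominus>\<^bsub>M\<^esub> x"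
proof -
  have "(\<ominus>\<^bsub>R\<^esub> \<one>\<^bsub>R\<^esub>) \<odot>\<^bsub>M\<^esub> x \<oplus>\<^bsub>M\<^esub> x = \<zero>\<^bsub>M\<^esub>"
    using smult_l_distr[of "\<ominus>\<^bsub>R\<^esub> \<one>\<^bsub>R\<^esub>" "\<one>\<^bsub>R\<^esub>" x] assms
    by (simp add: smult_one smult_l_null R.l_neg)
  then show ?thesis using assms smult_closed[of "\<ominus>\<^bsub>R\<^esub> \<one>\<^bsub>R\<^esub>" x]
    by (metis M.minus_equality R.add.inv_closed R.one_closed)
qed

lemma uminus_zero: "\<ominus>\<^bsub>M\<^esub> \<zero>\<^bsub>M\<^esub> = \<zero>\<^bsub>M\<^esub>"
  by (metis M.zero_closed R.add.inv_closed R.one_closed smult_minus_one smult_r_null)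

text \<open>Closure under negatives comes for free: \<open>- x\<close> is the multiple of \<open>x\<close> by \<open>- 1\<close>.\<close>

lemma right_submoduleI:
  assumes "H \<subseteq> carrier M" "\<zero>\<^bsub>M\<^esub> \<in> H"
    and "\<And>x y. x \<in> H \<Longrightarrow> y \<in> H \<Longrightarrow> x \<oplus>\<^bsub>M\<^esub> y \<in> H"
    and s: "\<And>a x. a \<in> carrier R \<Longrightarrow> x \<in> H \<Longrightarrow> a \<odot>\<^bsub>M\<^esub> x \<in> H"
  shows "submodule H R M"
proof -
  have "\<ominus>\<^bsub>M\<^esub> x \<in> H" if "x \<in> H" for x
    using s[of "\<ominus>\<^bsub>R\<^esub> \<one>\<^bsub>R\<^esub>" x] smult_minus_one[of x] that assms(1) by auto
  then show ?thesis
    using assms by (intro submodule.intro subgroup.intro submodule_axioms.intro)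
      (auto simp: a_inv_def)
qed

lemma
  assumes "submodule H R M"
  shows submodule_subset: "H \<subseteq> carrier M"
    and submodule_zero: "\<zero>\<^bsub>M\<^esub> \<in> H"
    and submodule_add: "\<And>x y. x \<in> H \<Longrightarrow> y \<in> H \<Longrightarrow> x \<oplus>\<^bsub>M\<^esub> y \<in> H"
    and submodule_uminus: "\<And>x. x \<in> H \<Longrightarrow> \<ominus>\<^bsub>M\<^esub> x \<in> H"
    and submodule_minus: "\<And>x y. x \<in> H \<Longrightarrow> y \<in> H \<Longrightarrow> x \<ominus>\<^bsub>M\<^esub> y \<in> H"
    and submodule_smult: "\<And>a x. a \<in> carrier R \<Longrightarrow> x \<in> H \<Longrightarrow> a \<odot>\<^bsub>M\<^esub> x \<in> H"
proof -
  have *: "subgroup H (add_monoid M)" using assms by (rule submodule.axioms(1))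
  show "H \<subseteq> carrier M" "\<zero>\<^bsub>M\<^esub> \<in> H"
    using subgroup.subset[OF *] subgroup.one_closed[OF *] by auto
  show 1: "\<And>x y. x \<in> H \<Longrightarrow> y \<in> H \<Longrightarrow> x \<oplus>\<^bsub>M\<^esub> y \<in> H"
    using subgroup.m_closed[OF *] by auto
  show 2: "\<And>x. x \<in> H \<Longrightarrow> \<ominus>\<^bsub>M\<^esub> x \<in> H"
    using subgroup.m_inv_closed[OF *] by (auto simp: a_inv_def)
  show "\<And>x y. x \<in> H \<Longrightarrow> y \<in> H \<Longrightarrow> x \<ominus>\<^bsub>M\<^esub> y \<in> H"
    using 1 2 by (simp add: a_minus_def)
  show "\<And>a x. a \<in> carrier R \<Longrightarrow> x \<in> H \<Longrightarrow> a \<odot>\<^bsub>M\<^esub> x \<in> H"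
    using submodule.smult_closed[OF assms] by auto
qed

lemma submodule_abelian_subgroup: "submodule H R M \<Longrightarrow> abelian_subgroup H M"
  by (intro abelian_subgroupI3 additive_subgroupI submodule.axioms(1) M.abelian_group_axioms)

lemma carrier_submodule: "submodule (carrier M) R M"
  by (intro right_submoduleI) (auto simp: smult_closed)

lemma zero_submodule: "submodule {\<zero>\<^bsub>M\<^esub>} R M"
  by (intro right_submoduleI) (auto simp: smult_r_null)

lemma submodule_sum:
  assumes A: "submodule A R M" and B: "submodule B R M"
  shows "submodule (A <+>\<^bsub>M\<^esub> B) R M"
proof (intro right_submoduleI)
  note cl = subsetD[OF submodule_subset[OF A]] subsetD[OF submodule_subset[OF B]]
  show "A <+>\<^bsub>M\<^esub> B \<subseteq> carrier M"
    using submodule_subset[OF A] submodule_subset[OF B] by (rule M.setadd_subset_G)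
  show "\<zero>\<^bsub>M\<^esub> \<in> A <+>\<^bsub>M\<^esub> B"
    unfolding set_add_def' using submodule_zero[OF A] submodule_zero[OF B] by force
  show "x \<oplus>\<^bsub>M\<^esub> y \<in> A <+>\<^bsub>M\<^esub> B" if xy: "x \<in> A <+>\<^bsub>M\<^esub> B" "y \<in> A <+>\<^bsub>M\<^esub> B" for x y
  proof -
    obtain a b a' b' where ab: "a \<in> A" "b \<in> B" "a' \<in> A" "b' \<in> B" "x = a \<oplus>\<^bsub>M\<^esub> b" "y = a' \<oplus>\<^bsub>M\<^esub> b'"
      using xy unfolding set_add_def' by auto
    then have "x \<oplus>\<^bsub>M\<^esub> y = (a \<oplus>\<^bsub>M\<^esub> a') \<oplus>\<^bsub>M\<^esub> (b \<oplus>\<^bsub>M\<^esub> b')"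
      using cl by (simp add: M.a_ac)
    then show ?thesis unfolding set_add_def'
      using ab submodule_add[OF A, of a a'] submodule_add[OF B, of b b'] by auto
  qed
  show "a \<odot>\<^bsub>M\<^esub> x \<in> A <+>\<^bsub>M\<^esub> B" if "a \<in> carrier R" "x \<in> A <+>\<^bsub>M\<^esub> B" for a x
    using that cl submodule_smult[OF A] submodule_smult[OF B]
    unfolding set_add_def' by (fastforce simp: smult_r_distr)
qed

lemma mod_span_submodule: assumes "A \<subseteq> carrier M" shows "submodule (mod_span R M A) R M"
  unfolding mod_span_def
  using assms carrier_submodule submodule_subset
  by (intro right_submoduleI) (auto intro: submodule_zero submodule_add submodule_smult)

lemma mod_span_carrier: "mod_span R M (carrier M) = carrier M"
  unfolding mod_span_def using carrier_submodule submodule_subset by blast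

lemma submodule_right_module: assumes "submodule H R M" shows "right_module R (M\<lparr>carrier := H\<rparr>)"
proof -
  note cl = subsetD[OF submodule_subset[OF assms]]
  have "abelian_group (M\<lparr>carrier := H\<rparr>)"
  proof (rule abelian_groupI; simp)
    fix x assume "x \<in> H"
    then show "\<exists>y\<in>H. y \<oplus>\<^bsub>M\<^esub> x = \<zero>\<^bsub>M\<^esub>"
      using submodule_uminus[OF assms] cl by (intro bexI[of _ "\<ominus>\<^bsub>M\<^esub> x"]) (auto simp: M.l_neg)
  qed (use assms cl in \<open>auto simp: submodule_add submodule_zero M.a_ac\<close>)
  then show ?thesis
    using assms cl R.ring_axioms
    by (intro right_module.intro right_module_axioms.intro)
      (auto simp: submodule_smult smult_l_distr smult_r_distr smult_assoc_right smult_one)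
qed

lemma submodule_of_submodule:
  assumes A: "submodule A R M" and B: "submodule B R M" and "A \<subseteq> B"
  shows "submodule A R (M\<lparr>carrier := B\<rparr>)"
proof -
  interpret B: right_module R "M\<lparr>carrier := B\<rparr>" by (rule submodule_right_module[OF B])
  show ?thesis using assms
    by (intro B.right_submoduleI) (auto simp: submodule_add submodule_zero submodule_smult)
qed

end

lemma mod_span_superset: "A \<subseteq> mod_span R M A"
  unfolding mod_span_def by auto

lemma mod_span_minimal: "submodule H R M \<Longrightarrow> A \<subseteq> H \<Longrightarrow> mod_span R M A \<subseteq> H"
  unfolding mod_span_def by auto

locale right_module_hom = A?: right_module R A + B?: right_module R B
  for R (structure) and A (structure) and B (structure) +
  fixes \<phi>
  assumes hom: "\<phi> \<in> mod_hom R A B"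
begin

lemma hom_closed: "x \<in> carrier A \<Longrightarrow> \<phi> x \<in> carrier B"
  and hom_add: "x \<in> carrier A \<Longrightarrow> y \<in> carrier A \<Longrightarrow> \<phi> (x \<oplus>\<^bsub>A\<^esub> y) = \<phi> x \<oplus>\<^bsub>B\<^esub> \<phi> y"
  and hom_smult: "a \<in> carrier R \<Longrightarrow> x \<in> carrier A \<Longrightarrow> \<phi> (a \<odot>\<^bsub>A\<^esub> x) = a \<odot>\<^bsub>B\<^esub> \<phi> x"
  using hom unfolding mod_hom_def by auto

lemma hom_zero: "\<phi> \<zero>\<^bsub>A\<^esub> = \<zero>\<^bsub>B\<^esub>"
  using hom_smult[of "\<zero>\<^bsub>R\<^esub>" "\<zero>\<^bsub>A\<^esub>"]
  by (simp add: A.smult_l_null B.smult_l_null hom_closed)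

lemma hom_uminus: "x \<in> carrier A \<Longrightarrow> \<phi> (\<ominus>\<^bsub>A\<^esub> x) = \<ominus>\<^bsub>B\<^esub> \<phi> x"
  using hom_smult[of "\<ominus>\<^bsub>R\<^esub> \<one>\<^bsub>R\<^esub>" x]
  by (simp add: A.smult_minus_one B.smult_minus_one hom_closed)

lemma hom_minus:
  "x \<in> carrier A \<Longrightarrow> y \<in> carrier A \<Longrightarrow> \<phi> (x \<ominus>\<^bsub>A\<^esub> y) = \<phi> x \<ominus>\<^bsub>B\<^esub> \<phi> y"
  by (simp add: a_minus_def hom_add hom_uminus)

lemma preimage_submodule:
  assumes "submodule H R B" shows "submodule {x \<in> carrier A. \<phi> x \<in> H} R A"
  using assms by (intro A.right_submoduleI)
    (auto simp: hom_zero hom_add hom_smult B.submodule_zero B.submodule_add B.submodule_smult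
      A.smult_closed)

lemma kernel_submodule: "submodule {x \<in> carrier A. \<phi> x = \<zero>\<^bsub>B\<^esub>} R A"
  using preimage_submodule[OF B.zero_submodule] by simp

lemma image_submodule: assumes H: "submodule H R A" shows "submodule (\<phi> ` H) R B"
proof (intro B.right_submoduleI)
  note cl = subsetD[OF A.submodule_subset[OF H]]
  show "\<phi> ` H \<subseteq> carrier B" using cl hom_closed by auto
  show "\<zero>\<^bsub>B\<^esub> \<in> \<phi> ` H" using A.submodule_zero[OF H] hom_zero by force
  show "x \<oplus>\<^bsub>B\<^esub> y \<in> \<phi> ` H" if xy: "x \<in> \<phi> ` H" "y \<in> \<phi> ` H" for x y
  proof -
    obtain u v where "u \<in> H" "v \<in> H" "x = \<phi> u" "y = \<phi> v" using xy by auto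
    then show ?thesis using A.submodule_add[OF H, of u v] hom_add[of u v] cl by force
  qed
  show "a \<odot>\<^bsub>B\<^esub> x \<in> \<phi> ` H" if ax: "a \<in> carrier R" "x \<in> \<phi> ` H" for a x
  proof -
    obtain u where "u \<in> H" "x = \<phi> u" using ax by auto
    then show ?thesis using A.submodule_smult[OF H, of a u] hom_smult[of a u] ax cl by force
  qed
qed

text \<open>
  A submodule that a homomorphism \<open>\<phi>\<close> carries bijectively onto the target is a direct summand:
  the inverse bijection is a section of \<open>\<phi>\<close>, and the kernel of \<open>\<phi>\<close> is a complement.
\<close>

lemma direct_sum_kernel:
  assumes C: "submodule C R A" and bij: "bij_betw \<phi> C (carrier B)"
  shows "internal_direct_sum R A C {x \<in> carrier A. \<phi> x = \<zero>\<^bsub>B\<^esub>}"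
proof -
  let ?K = "{x \<in> carrier A. \<phi> x = \<zero>\<^bsub>B\<^esub>}"
  note cl = subsetD[OF A.submodule_subset[OF C]]
  have "C <+>\<^bsub>A\<^esub> ?K = carrier A"
  proof
    show "C <+>\<^bsub>A\<^esub> ?K \<subseteq> carrier A" using cl by (intro A.M.setadd_subset_G) auto
    show "carrier A \<subseteq> C <+>\<^bsub>A\<^esub> ?K"
    proof
      fix x assume x: "x \<in> carrier A"
      then have "\<phi> x \<in> \<phi> ` C" using bij hom_closed unfolding bij_betw_def by auto
      then obtain c where c: "c \<in> C" "\<phi> c = \<phi> x" by auto
      have "x \<ominus>\<^bsub>A\<^esub> c \<in> ?K"
        using x c cl hom_closed[of x]
        by (simp add: hom_add hom_uminus a_minus_def B.M.r_neg)
      moreover have "x = c \<oplus>\<^bsub>A\<^esub> (x \<ominus>\<^bsub>A\<^esub> c)"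
      proof -
        have "c \<oplus>\<^bsub>A\<^esub> (x \<oplus>\<^bsub>A\<^esub> \<ominus>\<^bsub>A\<^esub> c) = x \<oplus>\<^bsub>A\<^esub> (c \<oplus>\<^bsub>A\<^esub> \<ominus>\<^bsub>A\<^esub> c)"
          using x cl[OF c(1)] by (intro A.M.a_lcomm) auto
        also have "\<dots> = x" using x cl[OF c(1)] by (simp add: A.M.r_neg)
        finally show ?thesis by (simp add: a_minus_def)
      qed
      ultimately show "x \<in> C <+>\<^bsub>A\<^esub> ?K" unfolding set_add_def' using c(1) by auto
    qed
  qed
  moreover have "C \<inter> ?K = {\<zero>\<^bsub>A\<^esub>}"
  proof -
    have "c = \<zero>\<^bsub>A\<^esub>" if "c \<in> C" "\<phi> c = \<zero>\<^bsub>B\<^esub>" for c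
      using bij that A.submodule_zero[OF C] hom_zero unfolding bij_betw_def inj_on_def by metis
    then have "C \<inter> ?K \<subseteq> {\<zero>\<^bsub>A\<^esub>}" by blast
    moreover have "\<zero>\<^bsub>A\<^esub> \<in> C \<inter> ?K" using A.submodule_zero[OF C] hom_zero by simp
    ultimately show ?thesis by blast
  qed
  ultimately show ?thesis using C kernel_submodule unfolding internal_direct_sum_def by simp
qed

lemma restrict_hom:
  assumes "submodule C R A" shows "right_module_hom R (A\<lparr>carrier := C\<rparr>) B \<phi>"
  using A.submodule_right_module[OF assms] B.right_module_axioms A.submodule_subset[OF assms]
    hom_closed hom_add hom_smult
  by (intro right_module_hom.intro right_module_hom_axioms.intro)
    (auto simp: mod_hom_def subset_iff)

end

lemma carrier_quot_module: "carrier (quot_module M H) = (\<lambda>x. H +>\<^bsub>M\<^esub> x) ` carrier M"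
  unfolding quot_module_def A_RCOSETS_def' by auto

lemma zero_quot_module: "\<zero>\<^bsub>quot_module M H\<^esub> = H"
  unfolding quot_module_def by simp

lemma add_quot_module: "X \<oplus>\<^bsub>quot_module M H\<^esub> Y = X <+>\<^bsub>M\<^esub> Y"
  unfolding quot_module_def by simp

text \<open>
  Shrinking the ambient module before or after dividing by \<open>H\<close> gives the same record, so that all
  quotients \<open>M\<^sub>\<mu>/M\<^sub>\<nu>\<close> may be treated as submodules of one module \<open>M/M\<^sub>\<nu>\<close>.
\<close>

lemma quot_module_restrict:
  "quot_module (M\<lparr>carrier := A\<rparr>) H = (quot_module M H)\<lparr>carrier := (\<lambda>x. H +>\<^bsub>M\<^esub> x) ` A\<rparr>"
  unfolding quot_module_def A_RCOSETS_def' set_add_def set_mult_def a_r_coset_def r_coset_def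
  by (auto simp: fun_eq_iff)

context right_module
begin

lemma coset_eq_iff:
  assumes H: "submodule H R M" and x: "x \<in> carrier M" and y: "y \<in> carrier M"
  shows "H +>\<^bsub>M\<^esub> x = H +>\<^bsub>M\<^esub> y \<longleftrightarrow> x \<ominus>\<^bsub>M\<^esub> y \<in> H"
proof
  interpret H: abelian_subgroup H M by (rule submodule_abelian_subgroup[OF H])
  assume "H +>\<^bsub>M\<^esub> x = H +>\<^bsub>M\<^esub> y"
  then have "x \<in> H +>\<^bsub>M\<^esub> y" using H.a_rcos_self[OF x] by simp
  then obtain h where "h \<in> H" "x = h \<oplus>\<^bsub>M\<^esub> y" unfolding a_r_coset_def' by auto
  then show "x \<ominus>\<^bsub>M\<^esub> y \<in> H"
    using y H.a_subset by (auto simp: a_minus_def M.a_assoc M.r_neg)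
next
  assume h: "x \<ominus>\<^bsub>M\<^esub> y \<in> H"
  have "x = (x \<ominus>\<^bsub>M\<^esub> y) \<oplus>\<^bsub>M\<^esub> y" using x y by (simp add: a_minus_def M.a_assoc M.l_neg)
  then have "x \<in> H +>\<^bsub>M\<^esub> y" using h unfolding a_r_coset_def' by auto
  then show "H +>\<^bsub>M\<^esub> x = H +>\<^bsub>M\<^esub> y"
    using M.a_repr_independence[OF _ y submodule.axioms(1)[OF H]] by simp
qed

lemma coset_eq_zero_iff:
  assumes H: "submodule H R M" and x: "x \<in> carrier M"
  shows "H +>\<^bsub>M\<^esub> x = H \<longleftrightarrow> x \<in> H"
  using coset_eq_iff[OF H x, of "\<zero>\<^bsub>M\<^esub>"] x M.a_coset_add_zero[OF submodule_subset[OF H]]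
  by (simp add: a_minus_def uminus_zero)

lemma quot_add:
  "\<lbrakk>submodule H R M; x \<in> carrier M; y \<in> carrier M\<rbrakk> \<Longrightarrow>
    (H +>\<^bsub>M\<^esub> x) \<oplus>\<^bsub>quot_module M H\<^esub> (H +>\<^bsub>M\<^esub> y) = H +>\<^bsub>M\<^esub> (x \<oplus>\<^bsub>M\<^esub> y)"
  using abelian_subgroup.a_rcos_sum[OF submodule_abelian_subgroup, of H x y]
  by (simp add: add_quot_module)

lemma quot_smult:
  assumes H: "submodule H R M" and a: "a \<in> carrier R" and x: "x \<in> carrier M"
  shows "a \<odot>\<^bsub>quot_module M H\<^esub> (H +>\<^bsub>M\<^esub> x) = H +>\<^bsub>M\<^esub> (a \<odot>\<^bsub>M\<^esub> x)"
proof -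
  interpret H: abelian_subgroup H M by (rule submodule_abelian_subgroup[OF H])
  have "H +>\<^bsub>M\<^esub> (a \<odot>\<^bsub>M\<^esub> y) = H +>\<^bsub>M\<^esub> (a \<odot>\<^bsub>M\<^esub> x)" if y: "y \<in> H +>\<^bsub>M\<^esub> x" for y
  proof -
    obtain h where h: "h \<in> H" "y = h \<oplus>\<^bsub>M\<^esub> x" using y unfolding a_r_coset_def' by auto
    then have "a \<odot>\<^bsub>M\<^esub> y \<in> H +>\<^bsub>M\<^esub> (a \<odot>\<^bsub>M\<^esub> x)"
      using a x H.a_subset submodule_smult[OF H a h(1)] unfolding a_r_coset_def'
      by (auto simp: smult_r_distr)
    then show ?thesis
      using M.a_repr_independence[OF _ smult_closed[OF a x] submodule.axioms(1)[OF H]] by simp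
  qed
  moreover have "H +>\<^bsub>M\<^esub> x \<noteq> {}" using H.a_rcos_self[OF x] by auto
  ultimately show ?thesis unfolding quot_module_def by auto
qed

lemma quot_right_module: assumes H: "submodule H R M" shows "right_module R (quot_module M H)"
proof -
  let ?Q = "quot_module M H"
  have zero: "\<zero>\<^bsub>?Q\<^esub> = H +>\<^bsub>M\<^esub> \<zero>\<^bsub>M\<^esub>"
    using submodule_subset[OF H] by (simp add: zero_quot_module)
  have "abelian_group ?Q"
  proof (rule abelian_groupI)
    fix X assume "X \<in> carrier ?Q"
    then obtain x where x: "x \<in> carrier M" "X = H +>\<^bsub>M\<^esub> x" by (auto simp: carrier_quot_module)
    then show "\<exists>Y\<in>carrier ?Q. Y \<oplus>\<^bsub>?Q\<^esub> X = \<zero>\<^bsub>?Q\<^esub>"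
      by (intro bexI[of _ "H +>\<^bsub>M\<^esub> (\<ominus>\<^bsub>M\<^esub> x)"])
        (auto simp: zero quot_add[OF H] M.l_neg carrier_quot_module)
  qed (auto simp: carrier_quot_module zero quot_add[OF H] M.a_ac)
  then show ?thesis
    using R.ring_axioms
    by (intro right_module.intro right_module_axioms.intro)
      (auto simp: carrier_quot_module quot_add[OF H] quot_smult[OF H] smult_closed
        smult_l_distr smult_r_distr smult_assoc_right smult_one)
qed

lemma coset_hom: "submodule H R M \<Longrightarrow> right_module_hom R M (quot_module M H) (\<lambda>x. H +>\<^bsub>M\<^esub> x)"
  by (intro right_module_hom.intro right_module_hom_axioms.intro quot_right_module
      right_module_axioms)
    (auto simp: mod_hom_def carrier_quot_module quot_add quot_smult)

end

text \<open>
  The map induced on cosets. The value is independent of the modules involved, which lets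
  one induced map serve all the submodules of a quotient.
\<close>

definition coset_lift :: "('a \<Rightarrow> 'b) \<Rightarrow> 'a set \<Rightarrow> 'b" where
  "coset_lift \<phi> X = the_elem (\<phi> ` X)"

context right_module_hom
begin

lemma coset_lift_apply:
  assumes H: "submodule H R A" "\<And>h. h \<in> H \<Longrightarrow> \<phi> h = \<zero>\<^bsub>B\<^esub>" and x: "x \<in> carrier A"
  shows "coset_lift \<phi> (H +>\<^bsub>A\<^esub> x) = \<phi> x"
proof -
  interpret H: abelian_subgroup H A by (rule A.submodule_abelian_subgroup[OF H(1)])
  have "\<phi> ` (H +>\<^bsub>A\<^esub> x) = {\<phi> x}"
    using H.a_rcos_self[OF x] x H H.a_subset hom_closed[OF x] unfolding a_r_coset_def'
    by (auto simp: hom_add)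
  then show ?thesis unfolding coset_lift_def by simp
qed

lemma coset_lift_hom:
  assumes "submodule H R A" "\<And>h. h \<in> H \<Longrightarrow> \<phi> h = \<zero>\<^bsub>B\<^esub>"
  shows "right_module_hom R (quot_module A H) B (coset_lift \<phi>)"
  using assms
  by (intro right_module_hom.intro right_module_hom_axioms.intro A.quot_right_module
      B.right_module_axioms)
    (auto simp: mod_hom_def carrier_quot_module A.quot_add A.quot_smult coset_lift_apply hom_closed
      hom_add hom_smult A.smult_closed)

end


section \<open>Direct sums of copies of a module\<close>

lemma mem_dsum_copies:
  "x \<in> carrier (dsum_copies J F) \<longleftrightarrow>
     (\<forall>j\<in>J. x j \<in> carrier F) \<and> (\<forall>j. j \<notin> J \<longrightarrow> x j = \<zero>\<^bsub>F\<^esub>) \<and> finite {j. x j \<noteq> \<zero>\<^bsub>F\<^esub>}"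
  by (simp add: dsum_copies_def)

lemma dsum_copies_simps:
  "\<zero>\<^bsub>dsum_copies J F\<^esub> = (\<lambda>j. \<zero>\<^bsub>F\<^esub>)"
  "x \<oplus>\<^bsub>dsum_copies J F\<^esub> y = (\<lambda>j. x j \<oplus>\<^bsub>F\<^esub> y j)"
  "a \<odot>\<^bsub>dsum_copies J F\<^esub> x = (\<lambda>j. a \<odot>\<^bsub>F\<^esub> x j)"
  by (simp_all add: dsum_copies_def)

lemma regular_right_module: assumes "ring R" shows "right_module R (regular_module R)"
proof -
  interpret ring R by (rule assms)
  have "abelian_group (regular_module R)"
  proof (rule abelian_groupI)
    fix x assume x: "x \<in> carrier (regular_module R)"
    show "\<exists>y\<in>carrier (regular_module R). y \<oplus>\<^bsub>regular_module R\<^esub> x = \<zero>\<^bsub>regular_module R\<^esub>"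
      using x by (intro bexI[of _ "\<ominus>\<^bsub>R\<^esub> x"]) (auto simp: regular_module_def l_neg)
  qed (auto simp: regular_module_def a_ac)
  then show ?thesis
    by (intro right_module.intro right_module_axioms.intro)
      (auto simp: assms regular_module_def l_distr r_distr m_assoc)
qed

context right_module
begin

lemma dsum_mem_coord: "x \<in> carrier (dsum_copies J M) \<Longrightarrow> x j \<in> carrier M"
  by (cases "j \<in> J") (auto simp: mem_dsum_copies)

lemma dsum_right_module: "right_module R (dsum_copies J M)"
proof -
  let ?S = "dsum_copies J M"
  have fin: "finite {j. u (x j) (y j) \<noteq> \<zero>\<^bsub>M\<^esub>}"
    if "u \<zero>\<^bsub>M\<^esub> \<zero>\<^bsub>M\<^esub> = \<zero>\<^bsub>M\<^esub>" "x \<in> carrier ?S" "y \<in> carrier ?S" for u x y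
  proof (rule finite_subset)
    show "{j. u (x j) (y j) \<noteq> \<zero>\<^bsub>M\<^esub>} \<subseteq> {j. x j \<noteq> \<zero>\<^bsub>M\<^esub>} \<union> {j. y j \<noteq> \<zero>\<^bsub>M\<^esub>}"
      using that(1) by force
    show "finite ({j. x j \<noteq> \<zero>\<^bsub>M\<^esub>} \<union> {j. y j \<noteq> \<zero>\<^bsub>M\<^esub>})"
      using that(2,3) unfolding mem_dsum_copies by simp
  qed
  have "abelian_group ?S"
  proof (rule abelian_groupI)
    fix x y assume xy: "x \<in> carrier ?S" "y \<in> carrier ?S"
    then show "x \<oplus>\<^bsub>?S\<^esub> y \<in> carrier ?S"
      using fin[of "(\<oplus>\<^bsub>M\<^esub>)" x y] by (auto simp: mem_dsum_copies dsum_copies_simps)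
    show "x \<oplus>\<^bsub>?S\<^esub> y = y \<oplus>\<^bsub>?S\<^esub> x"
      using xy by (simp add: dsum_copies_simps M.a_comm dsum_mem_coord)
    fix z assume "z \<in> carrier ?S"
    then show "x \<oplus>\<^bsub>?S\<^esub> y \<oplus>\<^bsub>?S\<^esub> z = x \<oplus>\<^bsub>?S\<^esub> (y \<oplus>\<^bsub>?S\<^esub> z)"
      using xy by (simp add: dsum_copies_simps M.a_assoc dsum_mem_coord)
  next
    fix x assume x: "x \<in> carrier ?S"
    then show "\<zero>\<^bsub>?S\<^esub> \<oplus>\<^bsub>?S\<^esub> x = x" by (simp add: dsum_copies_simps dsum_mem_coord)
    show "\<exists>y\<in>carrier ?S. y \<oplus>\<^bsub>?S\<^esub> x = \<zero>\<^bsub>?S\<^esub>"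
      using x fin[of "\<lambda>s _. \<ominus>\<^bsub>M\<^esub> s" x x] dsum_mem_coord[OF x]
      by (intro bexI[of _ "\<lambda>j. \<ominus>\<^bsub>M\<^esub> x j"])
        (auto simp: mem_dsum_copies dsum_copies_simps uminus_zero M.l_neg)
  qed (simp add: mem_dsum_copies dsum_copies_simps)
  moreover have "a \<odot>\<^bsub>?S\<^esub> x \<in> carrier ?S" if "a \<in> carrier R" "x \<in> carrier ?S" for a x
    using that fin[of "\<lambda>s _. a \<odot>\<^bsub>M\<^esub> s" x x]
    by (auto simp: mem_dsum_copies dsum_copies_simps smult_closed smult_r_null)
  ultimately show ?thesis
    using R.ring_axioms
    by (intro right_module.intro right_module_axioms.intro)
      (auto simp: dsum_copies_simps dsum_mem_coord smult_l_distr smult_r_distr smult_assoc_right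
        smult_one)
qed

lemma dsum_uminus:
  assumes "x \<in> carrier (dsum_copies J M)"
  shows "\<ominus>\<^bsub>dsum_copies J M\<^esub> x = (\<lambda>j. \<ominus>\<^bsub>M\<^esub> x j)"
proof -
  interpret S: right_module R "dsum_copies J M" by (rule dsum_right_module)
  show ?thesis
    using S.smult_minus_one[OF assms] smult_minus_one dsum_mem_coord[OF assms]
    by (auto simp: dsum_copies_simps fun_eq_iff)
qed

lemma dsum_minus:
  assumes "x \<in> carrier (dsum_copies J M)" "y \<in> carrier (dsum_copies J M)"
  shows "x \<ominus>\<^bsub>dsum_copies J M\<^esub> y = (\<lambda>j. x j \<ominus>\<^bsub>M\<^esub> y j)"
  using assms by (simp add: a_minus_def dsum_uminus dsum_copies_simps)

lemma copy_at_closed: "j \<in> J \<Longrightarrow> x \<in> carrier M \<Longrightarrow> copy_at M j x \<in> carrier (dsum_copies J M)"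
  by (auto simp: mem_dsum_copies copy_at_def intro: finite_subset[of _ "{j}"])

lemma dsum_subset_submodule:
  assumes "I \<subseteq> J" shows "submodule (carrier (dsum_copies I M)) R (dsum_copies J M)"
proof -
  interpret S: right_module R "dsum_copies J M" by (rule dsum_right_module)
  interpret T: right_module R "dsum_copies I M" by (rule dsum_right_module)
  have *: "carrier (dsum_copies I M) \<subseteq> carrier (dsum_copies J M)"
  proof
    fix x assume x: "x \<in> carrier (dsum_copies I M)"
    have "x j = \<zero>\<^bsub>M\<^esub>" if "j \<notin> J" for j
      using x assms that unfolding mem_dsum_copies by blast
    then show "x \<in> carrier (dsum_copies J M)"
      using x dsum_mem_coord[OF x] unfolding mem_dsum_copies by blast
  qed
  show ?thesis
    using * T.M.a_closed T.smult_closed T.M.zero_closed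
    by (intro S.right_submoduleI) (auto simp: dsum_copies_simps)
qed

end

text \<open>
  The homomorphism out of a direct sum that is \<open>\<phi> j\<close> on the \<open>j\<close>-th summand.
\<close>

definition dsum_lift ::
    "('r, 'f, 'y) module_scheme \<Rightarrow> ('r, 'b, 'z) module_scheme \<Rightarrow> ('j \<Rightarrow> 'f \<Rightarrow> 'b) \<Rightarrow> ('j \<Rightarrow> 'f) \<Rightarrow> 'b" where
  "dsum_lift F B \<phi> x = finsum B (\<lambda>j. \<phi> j (x j)) {j. x j \<noteq> \<zero>\<^bsub>F\<^esub>}"

lemma (in right_module) smult_finsum:
  assumes "finite S" "a \<in> carrier R" "\<And>j. j \<in> S \<Longrightarrow> u j \<in> carrier M"
  shows "a \<odot>\<^bsub>M\<^esub> finsum M u S = finsum M (\<lambda>j. a \<odot>\<^bsub>M\<^esub> u j) S"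
  using assms(1,3)
proof (induction S rule: finite_induct)
  case empty
  then show ?case using assms(2) by (simp add: M.finsum_empty smult_r_null)
next
  case (insert j S)
  then show ?case using assms(2)
    by (simp add: M.finsum_insert M.finsum_closed Pi_iff smult_r_distr smult_closed)
qed

lemma dsum_lift_hom:
  assumes F: "right_module R F" and B: "right_module R B"
    and hom: "\<And>j. j \<in> J \<Longrightarrow> right_module_hom R F B (\<phi> j)"
  shows "right_module_hom R (dsum_copies J F) B (dsum_lift F B \<phi>)"
proof -
  interpret F: right_module R F by (rule F)
  interpret B: right_module R B by (rule B)
  interpret S: right_module R "dsum_copies J F" by (rule F.dsum_right_module)
  let ?S = "dsum_copies J F"
  have cl: "\<phi> j (x j) \<in> carrier B" if "x \<in> carrier ?S" "j \<in> J" for x j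
    using that right_module_hom.hom_closed[OF hom] F.dsum_mem_coord[of x J j] by blast
  have supp: "{j. x j \<noteq> \<zero>\<^bsub>F\<^esub>} \<subseteq> J" "finite {j. x j \<noteq> \<zero>\<^bsub>F\<^esub>}" if "x \<in> carrier ?S" for x
    using that by (auto simp: mem_dsum_copies)
  \<comment> \<open>The sum may be taken over any finite set containing the support, so two
    elements can be compared over a common index set.\<close>
  have ext: "dsum_lift F B \<phi> x = finsum B (\<lambda>j. \<phi> j (x j)) K"
    if x: "x \<in> carrier ?S" and K: "finite K" "K \<subseteq> J" "{j. x j \<noteq> \<zero>\<^bsub>F\<^esub>} \<subseteq> K" for x K
    unfolding dsum_lift_def
  proof (rule B.M.add.finprod_mono_neutral_cong_left)
    show "\<phi> j (x j) = \<zero>\<^bsub>B\<^esub>" if "j \<in> K - {j. x j \<noteq> \<zero>\<^bsub>F\<^esub>}" for j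
      using that K right_module_hom.hom_zero[OF hom, of j] by auto
    show "(\<lambda>j. \<phi> j (x j)) \<in> K \<rightarrow> carrier B" using cl[OF x] K by auto
  qed (use K in auto)
  show ?thesis
  proof (intro right_module_hom.intro right_module_hom_axioms.intro S.right_module_axioms B)
    show "dsum_lift F B \<phi> \<in> mod_hom R ?S B"
      unfolding mod_hom_def mem_Collect_eq
    proof (intro conjI ballI)
      show "dsum_lift F B \<phi> \<in> carrier ?S \<rightarrow> carrier B"
        unfolding dsum_lift_def using cl supp by (intro Pi_I B.M.finsum_closed) blast
      fix x y assume x: "x \<in> carrier ?S" and y: "y \<in> carrier ?S"
      let ?K = "{j. x j \<noteq> \<zero>\<^bsub>F\<^esub>} \<union> {j. y j \<noteq> \<zero>\<^bsub>F\<^esub>}"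
      have K: "finite ?K" "?K \<subseteq> J" using supp[OF x] supp[OF y] by auto
      have xy: "x \<oplus>\<^bsub>?S\<^esub> y \<in> carrier ?S" using x y by simp
      have "dsum_lift F B \<phi> (x \<oplus>\<^bsub>?S\<^esub> y) = finsum B (\<lambda>j. \<phi> j (x j) \<oplus>\<^bsub>B\<^esub> \<phi> j (y j)) ?K"
      proof (subst ext[OF xy K])
        show "{j. (x \<oplus>\<^bsub>?S\<^esub> y) j \<noteq> \<zero>\<^bsub>F\<^esub>} \<subseteq> ?K" by (auto simp: dsum_copies_simps)
        show "finsum B (\<lambda>j. \<phi> j ((x \<oplus>\<^bsub>?S\<^esub> y) j)) ?K
            = finsum B (\<lambda>j. \<phi> j (x j) \<oplus>\<^bsub>B\<^esub> \<phi> j (y j)) ?K"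
          using K cl[OF x] cl[OF y] F.dsum_mem_coord[OF x] F.dsum_mem_coord[OF y]
            right_module_hom.hom_add[OF hom]
          by (intro B.M.add.finprod_cong') (auto simp: dsum_copies_simps)
      qed
      also have "\<dots> = finsum B (\<lambda>j. \<phi> j (x j)) ?K \<oplus>\<^bsub>B\<^esub> finsum B (\<lambda>j. \<phi> j (y j)) ?K"
        using K cl[OF x] cl[OF y] by (intro B.M.finsum_addf) auto
      also have "\<dots> = dsum_lift F B \<phi> x \<oplus>\<^bsub>B\<^esub> dsum_lift F B \<phi> y"
        using ext[OF x K] ext[OF y K] by auto
      finally show "dsum_lift F B \<phi> (x \<oplus>\<^bsub>?S\<^esub> y) = dsum_lift F B \<phi> x \<oplus>\<^bsub>B\<^esub> dsum_lift F B \<phi> y" .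
    next
      fix a x assume a: "a \<in> carrier R" and x: "x \<in> carrier ?S"
      let ?K = "{j. x j \<noteq> \<zero>\<^bsub>F\<^esub>}"
      have ax: "a \<odot>\<^bsub>?S\<^esub> x \<in> carrier ?S" using a x by (rule S.smult_closed)
      have "dsum_lift F B \<phi> (a \<odot>\<^bsub>?S\<^esub> x) = finsum B (\<lambda>j. a \<odot>\<^bsub>B\<^esub> \<phi> j (x j)) ?K"
      proof (subst ext[OF ax supp(2)[OF x] supp(1)[OF x]])
        show "{j. (a \<odot>\<^bsub>?S\<^esub> x) j \<noteq> \<zero>\<^bsub>F\<^esub>} \<subseteq> ?K"
          using a by (auto simp: dsum_copies_simps F.smult_r_null)
        show "finsum B (\<lambda>j. \<phi> j ((a \<odot>\<^bsub>?S\<^esub> x) j)) ?K = finsum B (\<lambda>j. a \<odot>\<^bsub>B\<^esub> \<phi> j (x j)) ?K"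
          using a supp[OF x] cl[OF x] F.dsum_mem_coord[OF x] right_module_hom.hom_smult[OF hom]
          by (intro B.M.add.finprod_cong') (auto simp: dsum_copies_simps B.smult_closed subset_iff)
      qed
      also have "\<dots> = a \<odot>\<^bsub>B\<^esub> dsum_lift F B \<phi> x"
        unfolding dsum_lift_def using supp[OF x] a cl[OF x]
        by (intro B.smult_finsum[symmetric]) auto
      finally show "dsum_lift F B \<phi> (a \<odot>\<^bsub>?S\<^esub> x) = a \<odot>\<^bsub>B\<^esub> dsum_lift F B \<phi> x" .
    qed
  qed
qed

lemma dsum_lift_copy_at:
  assumes "right_module_hom R F B (\<phi> j)" and x: "x \<in> carrier F"
  shows "dsum_lift F B \<phi> (copy_at F j x) = \<phi> j x"
proof -
  interpret right_module_hom R F B "\<phi> j" by (rule assms(1))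
  show ?thesis
  proof (cases "x = \<zero>\<^bsub>F\<^esub>")
    case True
    then show ?thesis
      by (simp add: dsum_lift_def copy_at_def hom_zero)
  next
    case False
    then have "{k. copy_at F j x k \<noteq> \<zero>\<^bsub>F\<^esub>} = {j}" by (auto simp: copy_at_def)
    then show ?thesis
      using hom_closed[OF x] by (simp add: dsum_lift_def copy_at_def)
  qed
qed

lemma dsum_lift_zero:
  assumes "right_module R B" "\<And>j. x j \<noteq> \<zero>\<^bsub>F\<^esub> \<Longrightarrow> \<phi> j (x j) = \<zero>\<^bsub>B\<^esub>"
  shows "dsum_lift F B \<phi> x = \<zero>\<^bsub>B\<^esub>"
proof -
  interpret B: right_module R B by (rule assms(1))
  show ?thesis unfolding dsum_lift_def
    by (rule B.M.add.finprod_one_eqI) (use assms(2) in auto)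
qed

text \<open>
  An element with support of size at most \<open>n + 1\<close> arises from one with support of size at most
  \<open>n\<close> by changing one value; so each size contributes at most \<open>|B|\<close> elements.
\<close>

lemma card_of_dsum_copies:
  assumes zero: "\<zero>\<^bsub>F\<^esub> \<in> carrier F"
    and inf: "infinite B" and J: "|J| \<le>o |B|" and F: "|carrier F| \<le>o |B|"
  shows "|carrier (dsum_copies J F)| \<le>o |B|"
proof -
  define S where "S n = {x \<in> carrier (dsum_copies J F). card {j. x j \<noteq> \<zero>\<^bsub>F\<^esub>} = n}" for n
  have co: "Card_order |B|" "infinite (Field |B| )"
    using inf by (auto simp: Field_card_of card_of_card_order_on)
  have "|S n| \<le>o |B|" for n
  proof (induction n)
    case 0
    have "S 0 \<subseteq> {\<lambda>j. \<zero>\<^bsub>F\<^esub>}" by (auto simp: S_def mem_dsum_copies)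
    moreover have "B \<noteq> {}" using inf by auto
    ultimately show ?case
      by (intro ordLeq_transitive[OF card_of_mono1 card_of_singl_ordLeq])
  next
    case (Suc n)
    let ?u = "\<lambda>(x, j, c). x(j := c)"
    have "S (Suc n) \<subseteq> ?u ` (S n \<times> J \<times> carrier F)"
    proof
      fix x assume x: "x \<in> S (Suc n)"
      have "{j. x j \<noteq> \<zero>\<^bsub>F\<^esub>} \<noteq> {}"
      proof
        assume "{j. x j \<noteq> \<zero>\<^bsub>F\<^esub>} = {}"
        then show False using x unfolding S_def mem_Collect_eq by (metis card.empty nat.distinct(1))
      qed
      then obtain j where j: "x j \<noteq> \<zero>\<^bsub>F\<^esub>" by blast
      let ?y = "x(j := \<zero>\<^bsub>F\<^esub>)"
      have supp: "{k. ?y k \<noteq> \<zero>\<^bsub>F\<^esub>} = {k. x k \<noteq> \<zero>\<^bsub>F\<^esub>} - {j}" by auto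
      have jJ: "j \<in> J" using x j by (auto simp: S_def mem_dsum_copies)
      moreover have "x j \<in> carrier F" using x jJ by (auto simp: S_def mem_dsum_copies)
      moreover have "?y \<in> S n"
        using x j zero unfolding S_def mem_Collect_eq mem_dsum_copies supp by auto
      moreover have "x = ?u (?y, j, x j)" by simp
      ultimately show "x \<in> ?u ` (S n \<times> J \<times> carrier F)" by blast
    qed
    then have "|S (Suc n)| \<le>o |?u ` (S n \<times> J \<times> carrier F)|" by (rule card_of_mono1)
    also have "|?u ` (S n \<times> J \<times> carrier F)| \<le>o |S n \<times> J \<times> carrier F|" by (rule card_of_image)
    also have "|S n \<times> J \<times> carrier F| \<le>o |B|"
      using Suc J F co by (intro card_of_Times_ordLeq_infinite_Field)
    finally show ?case .
  qed
  moreover have "carrier (dsum_copies J F) = (\<Union>n. S n)" by (auto simp: S_def)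
  ultimately show ?thesis
    using card_of_UNION_ordLeq_infinite[OF inf, of UNIV S] inf infinite_iff_card_of_nat by metis
qed


section \<open>Generation and presentation of small modules\<close>

context right_module
begin

lemma lt_generated_if_small: "|carrier M| <o |{..<\<mu>}| \<Longrightarrow> lt_generated R \<mu> M"
  unfolding lt_generated_def using mod_span_carrier by blast

lemma le_generated_if_small: "|carrier M| \<le>o |{..<\<mu>}| \<Longrightarrow> le_generated R \<mu> M"
  unfolding le_generated_def using mod_span_carrier by blast

lemma scalar_hom:
  assumes e: "e \<in> carrier M" shows "right_module_hom R (regular_module R) M (\<lambda>a. a \<odot>\<^bsub>M\<^esub> e)"
  using e by (intro right_module_hom.intro right_module_hom_axioms.intro regular_right_module
      R.ring_axioms right_module_axioms)
    (auto simp: mod_hom_def regular_module_def smult_closed smult_l_distr smult_assoc_right)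

text \<open>
  A module \<open>M\<close> with at most \<open>\<kappa>\<close> elements is the image of the free module on \<open>\<kappa>\<close>
  generators; if \<open>R\<close> has at most \<open>\<kappa>\<close> elements as well, then so has this free module, and the
  kernel generates itself.
\<close>

lemma lt_presented_if_small:
  fixes \<kappa> \<mu> :: "'o::wellorder"
  assumes inf: "infinite {..<\<kappa>}" and \<kappa>\<mu>: "|{..<\<kappa>}| <o |{..<\<mu>}|"
    and R: "|carrier R| \<le>o |{..<\<kappa>}|" and M: "|carrier M| \<le>o |{..<\<kappa>}|"
  shows "lt_presented R \<mu> M"
proof -
  let ?X = "{..<\<kappa>}" and ?reg = "regular_module R"
  let ?F = "dsum_copies ?X ?reg"
  interpret reg: right_module R ?reg by (rule regular_right_module[OF R.ring_axioms])
  interpret F: right_module R ?F by (rule reg.dsum_right_module)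
  have X: "?X \<subseteq> {..<\<mu>}"
  proof (rule ccontr)
    assume "\<not> ?X \<subseteq> {..<\<mu>}"
    then have "\<mu> < \<kappa>" by auto
    then have "|{..<\<mu>}| \<le>o |?X|" by (intro card_of_mono1) auto
    then show False using \<kappa>\<mu> not_ordLess_ordLeq by blast
  qed
  obtain e where e: "e ` ?X = carrier M"
    using M card_of_ordLeq2[of "carrier M" ?X] M.zero_closed by blast
  define \<phi> where "\<phi> = dsum_lift ?reg M (\<lambda>j a. a \<odot>\<^bsub>M\<^esub> e j)"
  have scal: "right_module_hom R ?reg M (\<lambda>a. a \<odot>\<^bsub>M\<^esub> e j)" if "j \<in> ?X" for j
    using that e by (intro scalar_hom) auto
  interpret phi: right_module_hom R ?F M \<phi>
    unfolding \<phi>_def using scal by (intro dsum_lift_hom reg.right_module_axioms right_module_axioms)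
  have "\<phi> ` carrier ?F = carrier M"
  proof
    show "\<phi> ` carrier ?F \<subseteq> carrier M" using phi.hom_closed by auto
    show "carrier M \<subseteq> \<phi> ` carrier ?F"
    proof
      fix x assume x: "x \<in> carrier M"
      then have "x \<in> e ` ?X" by (simp only: e)
      then obtain j where j: "j \<in> ?X" "e j = x" by blast
      have one: "\<one>\<^bsub>R\<^esub> \<in> carrier ?reg" by (simp add: regular_module_def)
      have "\<phi> (copy_at ?reg j \<one>\<^bsub>R\<^esub>) = x"
        using dsum_lift_copy_at[of R ?reg M "\<lambda>j a. a \<odot>\<^bsub>M\<^esub> e j" j, OF scal[OF j(1)] one] x
        by (simp add: smult_one \<phi>_def j(2))
      then show "x \<in> \<phi> ` carrier ?F" using reg.copy_at_closed[OF j(1) one] by blast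
    qed
  qed
  moreover have "lt_generated R \<mu> (?F\<lparr>carrier := a_kernel ?F M \<phi>\<rparr>)"
  proof -
    have ker: "a_kernel ?F M \<phi> = {x \<in> carrier ?F. \<phi> x = \<zero>\<^bsub>M\<^esub>}"
      by (auto simp: a_kernel_def kernel_def)
    interpret K: right_module R "?F\<lparr>carrier := a_kernel ?F M \<phi>\<rparr>"
      unfolding ker by (rule F.submodule_right_module[OF phi.kernel_submodule])
    have "|a_kernel ?F M \<phi>| \<le>o |carrier ?F|" unfolding ker by (intro card_of_mono1) auto
    also have "|carrier ?F| \<le>o |?X|"
      using R reg.M.zero_closed
      by (intro card_of_dsum_copies inf ordLeq_refl card_of_Card_order)
        (auto simp: regular_module_def)
    finally have "|a_kernel ?F M \<phi>| <o |{..<\<mu>}|" using \<kappa>\<mu> by (rule ordLeq_ordLess_trans)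
    then show ?thesis by (intro K.lt_generated_if_small) simp
  qed
  ultimately show ?thesis
    unfolding lt_presented_def Let_def using X \<kappa>\<mu> phi.hom by blast
qed

end


section \<open>Successors and ordinals of countable cofinality\<close>

lemma osuc_greater: "\<alpha> < \<beta> \<Longrightarrow> \<alpha> < osuc \<alpha>"
  unfolding osuc_def by (rule LeastI)

lemma less_osuc_iff: "\<alpha> < \<beta> \<Longrightarrow> \<gamma> < osuc \<alpha> \<longleftrightarrow> \<gamma> \<le> \<alpha>"
  using osuc_greater[of \<alpha> \<beta>] not_less_Least[of \<gamma> "\<lambda>\<beta>. \<alpha> < \<beta>"]
  unfolding osuc_def[symmetric] by (auto simp: not_less)

lemma osuc_le: "\<alpha> < \<beta> \<Longrightarrow> osuc \<alpha> \<le> \<beta>"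
  unfolding osuc_def by (rule Least_le)

text \<open>
  A successor ordinal has a cofinal subset with one element. The bound \<open>\<gamma> < \<beta>\<close> says that the
  type has room for the successor of \<open>\<gamma>\<close>.
\<close>

lemma osuc_not_cof_omega:
  assumes "\<gamma> < \<beta>" shows "\<not> has_cofinality (osuc \<gamma>) natLeq"
proof
  assume "has_cofinality (osuc \<gamma>) natLeq"
  moreover have "cofinal_in {\<gamma>} (osuc \<gamma>)"
    using assms by (auto simp: cofinal_in_def less_osuc_iff osuc_greater)
  ultimately have "natLeq \<le>o |{\<gamma>}|" unfolding has_cofinality_def by blast
  then have "|UNIV :: nat set| \<le>o |{\<gamma>}|"
    using ordIso_ordLeq_trans[OF card_of_nat] by blast
  then show False using card_of_ordLeq_finite[of "UNIV :: nat set" "{\<gamma>}"] by simp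
qed

lemma cof_omega_osuc_closed:
  assumes "has_cofinality \<nu> natLeq" "\<tau> < \<nu>" shows "osuc \<tau> < \<nu>"
  using osuc_le[OF assms(2)] osuc_not_cof_omega[OF assms(2)] assms(1) le_less by metis

text \<open>
  The terms of a ladder are successor ordinals; this makes each of them the index of a single copy
  of \<open>F\<close>.
\<close>

lemma ladder_not_cof_omega:
  assumes "ladder_system \<kappa>p s" and \<nu>: "\<nu> \<in> cof_omega \<kappa>p"
  shows "s \<nu> i \<notin> cof_omega \<kappa>p"
proof -
  have cof: "has_cofinality \<nu> natLeq" using \<nu> by (simp add: cof_omega_def)
  obtain \<tau> where \<tau>: "\<tau> < \<nu>" "s \<nu> i = (osuc ^^ Suc i) \<tau>"
    using assms unfolding ladder_system_def by blast
  have "(osuc ^^ n) \<tau> < \<nu>" for n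
    by (induction n) (auto simp: \<tau>(1) cof_omega_osuc_closed[OF cof])
  then show ?thesis
    using osuc_not_cof_omega[of "(osuc ^^ i) \<tau>" \<nu>] \<tau>(2) by (simp add: cof_omega_def)
qed

lemma card_below_successor_cardinal:
  assumes "successor_cardinal \<kappa> \<kappa>p"
  shows "|{..<\<kappa>}| <o |{..<\<kappa>p}|" and "\<alpha> < \<kappa>p \<Longrightarrow> |{..<\<alpha>}| \<le>o |{..<\<kappa>}|"
proof -
  have suc: "|{..<\<kappa>p}| =o cardSuc |{..<\<kappa>}|" and card: "is_cardinal \<kappa>p"
    using assms unfolding successor_cardinal_def by auto
  show "|{..<\<kappa>}| <o |{..<\<kappa>p}|"
    using ordLess_ordIso_trans[OF cardSuc_greater[OF card_of_Card_order] ordIso_symmetric[OF suc]] .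
  assume "\<alpha> < \<kappa>p"
  then have "|{..<\<alpha>}| <o |{..<\<kappa>p}|" using card unfolding is_cardinal_def by blast
  then have "|{..<\<alpha>}| <o cardSuc |{..<\<kappa>}|" using suc by (rule ordLess_ordIso_trans)
  then show "|{..<\<alpha>}| \<le>o |{..<\<kappa>}|"
    using cardSuc_ordLeq_ordLess[OF card_of_Card_order card_of_Card_order] by blast
qed

lemma card_of_slots_below:
  assumes inf: "infinite B" and \<alpha>: "|{..<\<alpha>}| \<le>o |B|"
  shows "|{j \<in> slots \<kappa>p. slot_ord j < \<alpha>}| \<le>o |B|"
proof -
  have co: "Card_order |B|" "infinite (Field |B| )"
    using inf by (auto simp: Field_card_of card_of_card_order_on)
  have nat: "|UNIV :: nat set| \<le>o |B|" using inf infinite_iff_card_of_nat by blast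
  have "|Single ` {..<\<alpha>}| \<le>o |B|" using ordLeq_transitive[OF card_of_image \<alpha>] .
  moreover have "|case_prod Double ` ({..<\<alpha>} \<times> UNIV)| \<le>o |B|"
    using ordLeq_transitive[OF card_of_image
        card_of_Times_ordLeq_infinite_Field[OF co(2) \<alpha> nat co(1)]] .
  ultimately have "|Single ` {..<\<alpha>} \<union> case_prod Double ` ({..<\<alpha>} \<times> UNIV)| \<le>o |B|"
    using co by (intro card_of_Un_ordLeq_infinite_Field)
  moreover have "{j \<in> slots \<kappa>p. slot_ord j < \<alpha>}
      \<subseteq> Single ` {..<\<alpha>} \<union> case_prod Double ` ({..<\<alpha>} \<times> UNIV)"
    by (auto simp: slots_def)
  ultimately show ?thesis using card_of_mono1 ordLeq_transitive by blast
qed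


section \<open>The construction\<close>

locale ladder_construction = F?: right_module R F
  for R :: "('r, 'x) ring_scheme" (structure) and F :: "('r, 'f, 'y) module_scheme" (structure) +
  fixes f :: "nat \<Rightarrow> 'f \<Rightarrow> 'f" and \<kappa>p :: "'o::wellorder" and s :: "'o \<Rightarrow> nat \<Rightarrow> 'o"
  assumes f: "\<And>i. f i \<in> mod_hom R F F"
    and ladder: "ladder_system \<kappa>p s"
begin

abbreviation "E \<equiv> cof_omega \<kappa>p"
abbreviation "P \<equiv> P_mod F \<kappa>p"
abbreviation "G \<equiv> G_sub R F f \<kappa>p s"
abbreviation "S \<equiv> dsum_copies (UNIV :: nat set) F"
abbreviation "N \<equiv> direct_limit R F f"

text \<open>The relations of the direct limit, so that \<open>N = S/D\<close>.\<close>

definition "D = mod_span R S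
  {copy_at F i x \<ominus>\<^bsub>S\<^esub> copy_at F (i + n) (transition f i n x) | i n x. x \<in> carrier F}"

text \<open>The preimage of \<open>M\<^sub>\<alpha>\<close> in \<open>P\<close>.\<close>

definition "U \<alpha> = P_below F \<kappa>p \<alpha> <+>\<^bsub>P\<^esub> G"

text \<open>The value of \<open>g\<^bsub>\<nu>i\<^esub>\<close> at \<open>x\<close>.\<close>

definition "relator \<nu> i x = copy_at F (Single (s \<nu> i)) x \<ominus>\<^bsub>P\<^esub> copy_at F (Double \<nu> i) x
  \<oplus>\<^bsub>P\<^esub> copy_at F (Double \<nu> (i + 1)) (f i x)"

sublocale P: right_module R P
  unfolding P_mod_def by (rule F.dsum_right_module)

sublocale S: right_module R S
  by (rule F.dsum_right_module)

sublocale f: right_module_hom R F F "f i" for i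
  using f by (intro right_module_hom.intro right_module_hom_axioms.intro F.right_module_axioms)

sublocale tr: right_module_hom R F F "transition f i n" for i n
proof (intro right_module_hom.intro right_module_hom_axioms.intro F.right_module_axioms)
  show "transition f i n \<in> mod_hom R F F"
    by (induction n) (auto simp: mod_hom_def Pi_iff f.hom_closed f.hom_add f.hom_smult)
qed

lemma E_less: "\<nu> \<in> E \<Longrightarrow> \<nu> < \<kappa>p"
  by (simp add: cof_omega_def)

lemma
  assumes "\<nu> \<in> E"
  shows ladder_less: "s \<nu> i < \<nu>" and ladder_strict_mono: "strict_mono (s \<nu>)"
    and ladder_notin_E: "s \<nu> i \<notin> E"
  using ladder assms ladder_not_cof_omega[OF ladder assms] unfolding ladder_system_def by blast+

lemma Single_slot: "\<nu> \<in> E \<Longrightarrow> Single (s \<nu> i) \<in> slots \<kappa>p"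
  and Double_slot: "\<nu> \<in> E \<Longrightarrow> Double \<nu> i \<in> slots \<kappa>p"
  using ladder_less[of \<nu> i] ladder_notin_E[of \<nu> i] E_less[of \<nu>] by (auto simp: slots_def)

lemma copy_P: "j \<in> slots \<kappa>p \<Longrightarrow> x \<in> carrier F \<Longrightarrow> copy_at F j x \<in> carrier P"
  unfolding P_mod_def by (rule F.copy_at_closed)

lemma copy_S: "x \<in> carrier F \<Longrightarrow> copy_at F i x \<in> carrier S"
  by (rule F.copy_at_closed) simp

lemma relator_closed: "\<nu> \<in> E \<Longrightarrow> x \<in> carrier F \<Longrightarrow> relator \<nu> i x \<in> carrier P"
  unfolding relator_def by (simp add: copy_P Single_slot Double_slot f.hom_closed)

lemma Im_g_eq: "Im_g F f \<kappa>p s \<nu> i = relator \<nu> i ` carrier F"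
  unfolding Im_g_def relator_def Let_def by auto

lemma G_at_subset: "\<nu> \<in> E \<Longrightarrow> G_at R F f \<kappa>p s \<nu> \<subseteq> carrier P"
  unfolding G_at_def Im_g_eq
  by (intro mod_span_minimal P.carrier_submodule) (auto simp: relator_closed)

lemma G_submodule: "submodule G R P"
  unfolding G_sub_def using G_at_subset by (intro P.mod_span_submodule) blast

lemma relator_in_G: "\<nu> \<in> E \<Longrightarrow> x \<in> carrier F \<Longrightarrow> relator \<nu> i x \<in> G"
proof -
  assume \<nu>: "\<nu> \<in> E" and x: "x \<in> carrier F"
  have "relator \<nu> i x \<in> (\<Union>i. Im_g F f \<kappa>p s \<nu> i)" using x by (auto simp: Im_g_eq)
  then have "relator \<nu> i x \<in> G_at R F f \<kappa>p s \<nu>" unfolding G_at_def by (rule subsetD[OF mod_span_superset])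
  then have "relator \<nu> i x \<in> (\<Union>\<alpha>\<in>E. G_at R F f \<kappa>p s \<alpha>)" using \<nu> by blast
  then show ?thesis unfolding G_sub_def by (rule subsetD[OF mod_span_superset])
qed

text \<open>
  Any containment \<open>G \<subseteq> H\<close>, and thus any statement that a homomorphism kills \<open>G\<close>, is checked on
  the generators.
\<close>

lemma G_minimal:
  assumes H: "submodule H R P" and g: "\<And>\<nu> i x. \<nu> \<in> E \<Longrightarrow> x \<in> carrier F \<Longrightarrow> relator \<nu> i x \<in> H"
  shows "G \<subseteq> H"
proof -
  have "G_at R F f \<kappa>p s \<nu> \<subseteq> H" if "\<nu> \<in> E" for \<nu>
    unfolding G_at_def Im_g_eq using that g by (intro mod_span_minimal H) auto
  then show ?thesis unfolding G_sub_def by (intro mod_span_minimal H) auto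
qed

lemma mem_P_below: "p \<in> P_below F \<kappa>p \<alpha> \<longleftrightarrow>
  p \<in> carrier P \<and> (\<forall>j. p j \<noteq> \<zero>\<^bsub>F\<^esub> \<longrightarrow> slot_ord j < \<alpha>)"
proof
  assume p: "p \<in> P_below F \<kappa>p \<alpha>"
  then have p': "p \<in> carrier (dsum_copies {j \<in> slots \<kappa>p. slot_ord j < \<alpha>} F)"
    by (simp add: P_below_def)
  have "p j \<in> carrier F" for j using F.dsum_mem_coord[OF p'] .
  then show "p \<in> carrier P \<and> (\<forall>j. p j \<noteq> \<zero>\<^bsub>F\<^esub> \<longrightarrow> slot_ord j < \<alpha>)"
    using p' unfolding P_mod_def mem_dsum_copies by blast
qed (auto simp: P_below_def P_mod_def mem_dsum_copies)

lemma P_below_submodule: "submodule (P_below F \<kappa>p \<alpha>) R P"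
  unfolding P_below_def P_mod_def by (rule F.dsum_subset_submodule) auto

lemma U_submodule: "submodule (U \<alpha>) R P"
  unfolding U_def by (rule P.submodule_sum[OF P_below_submodule G_submodule])

lemma P_below_subset_U: "P_below F \<kappa>p \<alpha> \<subseteq> U \<alpha>" and G_subset_U: "G \<subseteq> U \<alpha>"
proof -
  show "P_below F \<kappa>p \<alpha> \<subseteq> U \<alpha>"
  proof
    fix p assume p: "p \<in> P_below F \<kappa>p \<alpha>"
    then have "p = p \<oplus>\<^bsub>P\<^esub> \<zero>\<^bsub>P\<^esub>" by (simp add: mem_P_below)
    then show "p \<in> U \<alpha>"
      unfolding U_def set_add_def' using p P.submodule_zero[OF G_submodule] by blast
  qed
  show "G \<subseteq> U \<alpha>"
  proof
    fix g assume g: "g \<in> G"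
    then have "g = \<zero>\<^bsub>P\<^esub> \<oplus>\<^bsub>P\<^esub> g" using P.submodule_subset[OF G_submodule] by auto
    then show "g \<in> U \<alpha>"
      unfolding U_def set_add_def' using g P.submodule_zero[OF P_below_submodule] by blast
  qed
qed

lemma U_minimal:
  assumes H: "submodule H R P" and "P_below F \<kappa>p \<alpha> \<subseteq> H" "G \<subseteq> H"
  shows "U \<alpha> \<subseteq> H"
  using assms unfolding U_def set_add_def' by (auto intro: P.submodule_add[OF H])

lemma direct_limit_eq: "N = quot_module S D"
  unfolding direct_limit_def D_def Let_def by simp

lemma D_submodule: "submodule D R S"
  unfolding D_def using copy_S tr.hom_closed by (intro S.mod_span_submodule) auto

lemma N_right_module: "right_module R N"
  unfolding direct_limit_eq by (rule S.quot_right_module[OF D_submodule])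

lemma relation_in_D: "x \<in> carrier F \<Longrightarrow> copy_at F i x \<ominus>\<^bsub>S\<^esub> copy_at F (i + n) (transition f i n x) \<in> D"
  unfolding D_def by (intro subsetD[OF mod_span_superset]) blast


subsection \<open>The layer at an ordinal of countable cofinality\<close>

text \<open>
  For \<open>\<nu> \<in> E\<close> these are the projection of \<open>P\<close> onto its summand \<open>F\<^sub>\<nu>\<close> and the inclusion of \<open>F\<^sub>\<nu>\<close>,
  where \<open>F\<^sub>\<nu>\<close> is identified with the direct sum \<open>S\<close> from which \<open>N\<close> is built.
\<close>

definition layer :: "'o \<Rightarrow> ('o slot \<Rightarrow> 'f) \<Rightarrow> nat \<Rightarrow> 'f" where
  "layer \<nu> p = (\<lambda>i. p (Double \<nu> i))"

definition unlayer :: "'o \<Rightarrow> (nat \<Rightarrow> 'f) \<Rightarrow> 'o slot \<Rightarrow> 'f" where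
  "unlayer \<nu> y j = (case j of Single _ \<Rightarrow> \<zero>\<^bsub>F\<^esub> | Double \<alpha> i \<Rightarrow> if \<alpha> = \<nu> then y i else \<zero>\<^bsub>F\<^esub>)"

lemma P_coord: "p \<in> carrier P \<Longrightarrow> p j \<in> carrier F"
  unfolding P_mod_def by (rule F.dsum_mem_coord)

lemma P_simps:
  "\<zero>\<^bsub>P\<^esub> = (\<lambda>j. \<zero>\<^bsub>F\<^esub>)"
  "x \<oplus>\<^bsub>P\<^esub> y = (\<lambda>j. x j \<oplus>\<^bsub>F\<^esub> y j)"
  "a \<odot>\<^bsub>P\<^esub> x = (\<lambda>j. a \<odot>\<^bsub>F\<^esub> x j)"
  by (simp_all add: P_mod_def dsum_copies_simps)

lemma layer_hom: "right_module_hom R P S (layer \<nu>)"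
proof (intro right_module_hom.intro right_module_hom_axioms.intro P.right_module_axioms
    S.right_module_axioms)
  have "layer \<nu> p \<in> carrier S" if p: "p \<in> carrier P" for p
  proof -
    have "finite {j. p j \<noteq> \<zero>\<^bsub>F\<^esub>}" using p by (simp add: P_mod_def mem_dsum_copies)
    then have "finite (Double \<nu> -` {j. p j \<noteq> \<zero>\<^bsub>F\<^esub>})"
      by (rule finite_vimageI) (simp add: inj_def)
    then show ?thesis using P_coord[OF p] by (simp add: mem_dsum_copies layer_def vimage_def)
  qed
  then show "layer \<nu> \<in> mod_hom R P S"
    by (auto simp: mod_hom_def P_simps dsum_copies_simps layer_def)
qed

sublocale layer: right_module_hom R P S "layer \<nu>" for \<nu>
  by (rule layer_hom)

lemma unlayer_hom: assumes \<nu>: "\<nu> \<in> E" shows "right_module_hom R S P (unlayer \<nu>)"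
proof (intro right_module_hom.intro right_module_hom_axioms.intro P.right_module_axioms
    S.right_module_axioms)
  have "unlayer \<nu> y \<in> carrier P" if y: "y \<in> carrier S" for y
  proof -
    have "finite {i. y i \<noteq> \<zero>\<^bsub>F\<^esub>}" using y by (simp add: mem_dsum_copies)
    moreover have "{j. unlayer \<nu> y j \<noteq> \<zero>\<^bsub>F\<^esub>} \<subseteq> Double \<nu> ` {i. y i \<noteq> \<zero>\<^bsub>F\<^esub>}"
    proof
      fix j assume "j \<in> {j. unlayer \<nu> y j \<noteq> \<zero>\<^bsub>F\<^esub>}"
      then show "j \<in> Double \<nu> ` {i. y i \<noteq> \<zero>\<^bsub>F\<^esub>}"
        by (cases j) (auto simp: unlayer_def split: if_splits)
    qed
    ultimately have "finite {j. unlayer \<nu> y j \<noteq> \<zero>\<^bsub>F\<^esub>}" using finite_surj by blast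
    then show ?thesis using F.dsum_mem_coord[OF y] Double_slot[OF \<nu>]
      by (auto simp: P_mod_def mem_dsum_copies unlayer_def split: slot.splits)
  qed
  then show "unlayer \<nu> \<in> mod_hom R S P"
    by (auto simp: mod_hom_def P_simps dsum_copies_simps unlayer_def F.smult_r_null fun_eq_iff
        split: slot.splits)
qed

lemma layer_copy_at:
  "layer \<nu> (copy_at F (Single \<beta>) x) = \<zero>\<^bsub>S\<^esub>"
  "layer \<nu> (copy_at F (Double \<nu> i) x) = copy_at F i x"
  "\<alpha> \<noteq> \<nu> \<Longrightarrow> layer \<nu> (copy_at F (Double \<alpha> i) x) = \<zero>\<^bsub>S\<^esub>"
  by (auto simp: layer_def copy_at_def dsum_copies_simps)

lemma unlayer_copy_at: "unlayer \<nu> (copy_at F i x) = copy_at F (Double \<nu> i) x"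
  by (auto simp: unlayer_def copy_at_def fun_eq_iff split: slot.splits)

lemma layer_unlayer: "layer \<nu> (unlayer \<nu> y) = y"
  by (simp add: layer_def unlayer_def)

lemma unlayer_in_P_below:
  assumes "\<nu> \<in> E" "y \<in> carrier S" "\<nu> < \<alpha>" shows "unlayer \<nu> y \<in> P_below F \<kappa>p \<alpha>"
  using right_module_hom.hom_closed[OF unlayer_hom[OF assms(1)] assms(2)] assms(3)
  by (auto simp: mem_P_below unlayer_def split: slot.splits if_splits)

text \<open>
  The generators at \<open>\<alpha> \<noteq> \<nu>\<close> have no component in \<open>F\<^sub>\<nu>\<close>: their component outside \<open>F\<^sub>\<alpha>\<close> sits at
  \<open>s\<^sub>\<alpha>(i) \<notin> E\<close>. The components of the generators at \<open>\<nu>\<close> are the negatives of relations of \<open>N\<close>.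
\<close>

lemma layer_U:
  assumes "p \<in> U \<nu>" shows "layer \<nu> p \<in> D"
proof -
  have "U \<nu> \<subseteq> {p \<in> carrier P. layer \<nu> p \<in> D}"
  proof (intro U_minimal G_minimal layer.preimage_submodule D_submodule)
    show "P_below F \<kappa>p \<nu> \<subseteq> {p \<in> carrier P. layer \<nu> p \<in> D}"
    proof
      fix p assume p: "p \<in> P_below F \<kappa>p \<nu>"
      then have "p (Double \<nu> i) = \<zero>\<^bsub>F\<^esub>" for i
        unfolding mem_P_below using less_irrefl slot_ord.simps(2) by metis
      then have "layer \<nu> p = \<zero>\<^bsub>S\<^esub>" by (simp add: layer_def dsum_copies_simps)
      then show "p \<in> {p \<in> carrier P. layer \<nu> p \<in> D}"
        using p S.submodule_zero[OF D_submodule] by (simp add: mem_P_below)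
    qed
    fix \<alpha> i x assume \<alpha>: "\<alpha> \<in> E" and x: "x \<in> carrier F"
    have eq: "layer \<nu> (relator \<alpha> i x) = layer \<nu> (copy_at F (Single (s \<alpha> i)) x)
      \<ominus>\<^bsub>S\<^esub> layer \<nu> (copy_at F (Double \<alpha> i) x) \<oplus>\<^bsub>S\<^esub> layer \<nu> (copy_at F (Double \<alpha> (i + 1)) (f i x))"
      unfolding relator_def using \<alpha> x copy_P Single_slot Double_slot f.hom_closed
      by (simp add: layer.hom_add layer.hom_minus)
    have "layer \<nu> (relator \<alpha> i x) \<in> D"
    proof (cases "\<alpha> = \<nu>")
      case True
      have c: "copy_at F i x \<in> carrier S" "copy_at F (i + 1) (f i x) \<in> carrier S"
        using x f.hom_closed copy_S by blast+
      have "layer \<nu> (relator \<alpha> i x) = \<ominus>\<^bsub>S\<^esub> (copy_at F i x \<ominus>\<^bsub>S\<^esub> copy_at F (i + 1) (f i x))"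
        unfolding eq using c by (simp add: True layer_copy_at a_minus_def S.M.minus_add)
      moreover have "copy_at F i x \<ominus>\<^bsub>S\<^esub> copy_at F (i + 1) (f i x) \<in> D"
        using relation_in_D[OF x, of i 1] by simp
      ultimately show ?thesis using S.submodule_uminus[OF D_submodule] by simp
    next
      case False
      then show ?thesis
        using S.submodule_zero[OF D_submodule]
        by (simp add: eq layer_copy_at a_minus_def S.uminus_zero)
    qed
    then show "relator \<alpha> i x \<in> {p \<in> carrier P. layer \<nu> p \<in> D}" using relator_closed[OF \<alpha> x] by simp
  qed
  then show ?thesis using assms by blast
qed

text \<open>
  The remaining term of the generator is at \<open>s\<^sub>\<nu>(i)\<close>. It lies below \<open>\<nu>\<close> and so vanishes modulo \<open>U\<^sub>\<nu>\<close>.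
\<close>

lemma step_in_U:
  assumes \<nu>: "\<nu> \<in> E" and x: "x \<in> carrier F"
  shows "copy_at F (Double \<nu> i) x \<ominus>\<^bsub>P\<^esub> copy_at F (Double \<nu> (i + 1)) (f i x) \<in> U \<nu>"
proof -
  let ?a = "copy_at F (Single (s \<nu> i)) x" and ?b = "copy_at F (Double \<nu> i) x"
    and ?c = "copy_at F (Double \<nu> (i + 1)) (f i x)"
  have cl: "?a \<in> carrier P" "?b \<in> carrier P" "?c \<in> carrier P"
    using \<nu> x copy_P Single_slot Double_slot f.hom_closed by blast+
  have "?a \<in> P_below F \<kappa>p \<nu>"
    using cl(1) ladder_less[OF \<nu>] by (auto simp: mem_P_below copy_at_def)
  then have "?a \<ominus>\<^bsub>P\<^esub> relator \<nu> i x \<in> U \<nu>"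
    using subsetD[OF P_below_subset_U] subsetD[OF G_subset_U relator_in_G[OF \<nu> x]]
    by (intro P.submodule_minus[OF U_submodule])
  moreover have "?a \<ominus>\<^bsub>P\<^esub> relator \<nu> i x = ?b \<ominus>\<^bsub>P\<^esub> ?c"
  proof -
    have "?a \<ominus>\<^bsub>P\<^esub> relator \<nu> i x = ?a \<oplus>\<^bsub>P\<^esub> (\<ominus>\<^bsub>P\<^esub> ?a \<oplus>\<^bsub>P\<^esub> (?b \<oplus>\<^bsub>P\<^esub> \<ominus>\<^bsub>P\<^esub> ?c))"
      unfolding relator_def using cl by (simp add: a_minus_def P.M.minus_add P.M.a_assoc)
    also have "\<dots> = ?b \<ominus>\<^bsub>P\<^esub> ?c" using cl by (simp add: a_minus_def P.M.r_neg2)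
    finally show ?thesis .
  qed
  ultimately show ?thesis by simp
qed

text \<open>
  A relation of \<open>N\<close> between places \<open>i\<close> and \<open>i + n\<close> telescopes into \<open>n\<close> relations
  between neighbouring places.
\<close>

lemma unlayer_D:
  assumes \<nu>: "\<nu> \<in> E" and y: "y \<in> D" shows "unlayer \<nu> y \<in> U \<nu>"
proof -
  interpret unlayer: right_module_hom R S P "unlayer \<nu>" by (rule unlayer_hom[OF \<nu>])
  have "D \<subseteq> {y \<in> carrier S. unlayer \<nu> y \<in> U \<nu>}"
    unfolding D_def
  proof (intro mod_span_minimal unlayer.preimage_submodule U_submodule subsetI)
    fix z assume "z \<in> {copy_at F i x \<ominus>\<^bsub>S\<^esub> copy_at F (i + n) (transition f i n x) |i n x. x \<in> carrier F}"
    then obtain i n x where z: "z = copy_at F i x \<ominus>\<^bsub>S\<^esub> copy_at F (i + n) (transition f i n x)"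
      and x: "x \<in> carrier F" by blast
    have cl: "copy_at F (Double \<nu> (i + n)) (transition f i n x) \<in> carrier P" for n
      using copy_P[OF Double_slot[OF \<nu>] tr.hom_closed[OF x]] .
    have "copy_at F (Double \<nu> i) x \<ominus>\<^bsub>P\<^esub> copy_at F (Double \<nu> (i + n)) (transition f i n x) \<in> U \<nu>"
    proof (induction n)
      case 0
      have "copy_at F (Double \<nu> i) x \<in> carrier P" using copy_P[OF Double_slot[OF \<nu>] x] .
      then show ?case
        using P.submodule_zero[OF U_submodule] by (simp add: a_minus_def P.M.r_neg)
    next
      case (Suc n)
      let ?a = "copy_at F (Double \<nu> i) x"
        and ?b = "copy_at F (Double \<nu> (i + n)) (transition f i n x)"
        and ?c = "copy_at F (Double \<nu> (i + Suc n)) (transition f i (Suc n) x)"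
      have a: "?a \<in> carrier P" using copy_P[OF Double_slot[OF \<nu>] x] .
      have "?b \<ominus>\<^bsub>P\<^esub> ?c \<in> U \<nu>"
        using step_in_U[OF \<nu> tr.hom_closed[OF x, of i n], of "i + n"] by simp
      then have "(?a \<ominus>\<^bsub>P\<^esub> ?b) \<oplus>\<^bsub>P\<^esub> (?b \<ominus>\<^bsub>P\<^esub> ?c) \<in> U \<nu>"
        by (rule P.submodule_add[OF U_submodule Suc])
      moreover have "(?a \<ominus>\<^bsub>P\<^esub> ?b) \<oplus>\<^bsub>P\<^esub> (?b \<ominus>\<^bsub>P\<^esub> ?c) = ?a \<ominus>\<^bsub>P\<^esub> ?c"
        using a cl[of n] cl[of "Suc n"] unfolding a_minus_def
        by (simp only: P.M.a_assoc P.M.a_closed P.M.a_inv_closed P.M.r_neg1)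
      ultimately show ?case by simp
    qed
    then have "unlayer \<nu> z \<in> U \<nu>"
      using x copy_S tr.hom_closed by (simp add: z unlayer.hom_minus unlayer_copy_at)
    then show "z \<in> {y \<in> carrier S. unlayer \<nu> y \<in> U \<nu>}"
      using x copy_S tr.hom_closed by (simp add: z)
  qed
  then show ?thesis using y by blast
qed

text \<open>
  What remains of \<open>p\<close> after its component in \<open>F\<^sub>\<nu>\<close> has been removed lies strictly below \<open>\<nu>\<close>.
\<close>

lemma mem_U_if_layer:
  assumes \<nu>: "\<nu> \<in> E" and p: "p \<in> P_below F \<kappa>p (osuc \<nu>)" and D: "layer \<nu> p \<in> D"
  shows "p \<in> U \<nu>"
proof -
  interpret unlayer: right_module_hom R S P "unlayer \<nu>" by (rule unlayer_hom[OF \<nu>])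
  let ?u = "unlayer \<nu> (layer \<nu> p)"
  have pP: "p \<in> carrier P" using p by (simp add: mem_P_below)
  then have u: "?u \<in> carrier P" using layer.hom_closed unlayer.hom_closed by blast
  have dP: "p \<ominus>\<^bsub>P\<^esub> ?u \<in> carrier P" using pP u by simp
  have d: "(p \<ominus>\<^bsub>P\<^esub> ?u) j = p j \<ominus>\<^bsub>F\<^esub> ?u j" for j
    using F.dsum_minus[of p "slots \<kappa>p" ?u] pP u by (simp add: P_mod_def)
  have "slot_ord j < \<nu>" if j: "(p \<ominus>\<^bsub>P\<^esub> ?u) j \<noteq> \<zero>\<^bsub>F\<^esub>" for j
  proof (rule ccontr)
    assume neg: "\<not> slot_ord j < \<nu>"
    have "(p \<ominus>\<^bsub>P\<^esub> ?u) j = \<zero>\<^bsub>F\<^esub>"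
    proof (cases "slot_ord j = \<nu>")
      case True
      show ?thesis
      proof (cases j)
        case (Single \<beta>)
        then have "j \<notin> slots \<kappa>p" using True \<nu> by (auto simp: slots_def)
        then show ?thesis using dP by (simp add: P_mod_def mem_dsum_copies)
      next
        case (Double \<beta> i)
        then have "?u j = p j" using True by (simp add: unlayer_def layer_def)
        then show ?thesis unfolding d using P_coord[OF pP] by (simp add: a_minus_def F.M.r_neg)
      qed
    next
      case False
      then have "\<not> slot_ord j < osuc \<nu>"
        using neg less_osuc_iff[OF E_less[OF \<nu>]] by auto
      then have "p j = \<zero>\<^bsub>F\<^esub>" using p unfolding mem_P_below by blast
      moreover have "?u j = \<zero>\<^bsub>F\<^esub>" using False by (auto simp: unlayer_def split: slot.splits)
      ultimately show ?thesis unfolding d by (simp add: a_minus_def F.uminus_zero)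
    qed
    then show False using j by simp
  qed
  then have "p \<ominus>\<^bsub>P\<^esub> ?u \<in> U \<nu>" using dP P_below_subset_U[of \<nu>] by (auto simp: mem_P_below)
  then have "(p \<ominus>\<^bsub>P\<^esub> ?u) \<oplus>\<^bsub>P\<^esub> ?u \<in> U \<nu>"
    using unlayer_D[OF \<nu> D] by (rule P.submodule_add[OF U_submodule])
  then show ?thesis using pP u by (simp add: a_minus_def P.M.a_assoc P.M.l_neg)
qed


subsection \<open>Strictness at the remaining ordinals\<close>

text \<open>
  The homomorphism \<open>P \<rightarrow> F\<close> that is the identity on \<open>F\<^sub>\<alpha>\<close>, prescribed on each summand. On
  \<open>F\<^bsub>\<nu>,i\<^esub>\<close> it is the map along the direct system up to the place \<open>i + n\<close> at which the ladder at \<open>\<nu>\<close>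
  passes through \<open>\<alpha>\<close>, and \<open>0\<close> if the ladder has passed \<open>\<alpha>\<close> before \<open>i\<close> or avoids it.
  A ladder meets \<open>\<alpha>\<close> at most once, so \<open>LEAST\<close> merely picks out that place.
\<close>

definition chase :: "'o \<Rightarrow> 'o slot \<Rightarrow> 'f \<Rightarrow> 'f" where
  "chase \<alpha> j = (case j of
      Single \<beta> \<Rightarrow> if \<beta> = \<alpha> then id else (\<lambda>_. \<zero>\<^bsub>F\<^esub>)
    | Double \<nu> i \<Rightarrow> if \<exists>n. s \<nu> (i + n) = \<alpha> then transition f i (LEAST n. s \<nu> (i + n) = \<alpha>)
        else (\<lambda>_. \<zero>\<^bsub>F\<^esub>))"

lemma chase_hom: "right_module_hom R F F (chase \<alpha> j)"
proof -
  have z: "right_module_hom R F F (\<lambda>_. \<zero>\<^bsub>F\<^esub>)" and i: "right_module_hom R F F id"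
    by (intro right_module_hom.intro right_module_hom_axioms.intro F.right_module_axioms;
        simp add: mod_hom_def F.smult_r_null)+
  show ?thesis
    using z i tr.right_module_hom_axioms by (cases j) (simp_all add: chase_def)
qed

lemma transition_Suc: "transition f i (Suc n) x = transition f (Suc i) n (f i x)"
  by (induction n) auto

text \<open>
  Going from \<open>i\<close> to the place of \<open>\<alpha>\<close> is the same as taking one step by \<open>f\<^sub>i\<close> and going on from
  there, unless \<open>\<alpha>\<close> is at the place \<open>i\<close> itself; then the term at \<open>s\<^sub>\<nu>(i) = \<alpha>\<close> cancels instead.
\<close>

lemma chase_relator:
  assumes \<nu>: "\<nu> \<in> E" and x: "x \<in> carrier F"
  shows "chase \<alpha> (Single (s \<nu> i)) x \<ominus>\<^bsub>F\<^esub> chase \<alpha> (Double \<nu> i) x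
    \<oplus>\<^bsub>F\<^esub> chase \<alpha> (Double \<nu> (i + 1)) (f i x) = \<zero>\<^bsub>F\<^esub>"
proof -
  have inj: "s \<nu> k = s \<nu> l \<longleftrightarrow> k = l" for k l
    using ladder_strict_mono[OF \<nu>] by (rule strict_mono_eq)
  consider (here) "s \<nu> i = \<alpha>" | (later) n where "s \<nu> (i + Suc n) = \<alpha>"
    | (never) "\<forall>n. s \<nu> (i + n) \<noteq> \<alpha>"
    by (metis add_0_right not0_implies_Suc)
  then show ?thesis
  proof cases
    case here
    have 1: "(LEAST n. s \<nu> (i + n) = \<alpha>) = 0" "\<exists>n. s \<nu> (i + n) = \<alpha>"
      using here by (auto intro: exI[of _ 0])
    have 2: "\<nexists>n. s \<nu> (i + 1 + n) = \<alpha>" using here inj by (metis add.assoc add_cancel_left_right add_is_0 one_neq_zero)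
    show ?thesis
      unfolding chase_def using here 1 2 x by (simp add: a_minus_def F.M.r_neg)
  next
    case later
    have 0: "s \<nu> i \<noteq> \<alpha>" using later inj[of i "i + Suc n"] by auto
    have "s \<nu> (i + m) = \<alpha> \<longleftrightarrow> m = Suc n" for m using later inj[of "i + m" "i + Suc n"] by auto
    then have 1: "(LEAST m. s \<nu> (i + m) = \<alpha>) = Suc n" "\<exists>m. s \<nu> (i + m) = \<alpha>"
      by (simp_all add: Least_equality)
    have "s \<nu> (i + 1 + m) = \<alpha> \<longleftrightarrow> m = n" for m
      using later inj[of "i + 1 + m" "i + Suc n"] by auto
    then have 2: "(LEAST m. s \<nu> (i + 1 + m) = \<alpha>) = n" "\<exists>m. s \<nu> (i + 1 + m) = \<alpha>"
      by (simp_all add: Least_equality)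
    have "chase \<alpha> (Double \<nu> i) x = transition f (Suc i) n (f i x)"
      unfolding chase_def using 1 by (simp del: transition.simps add: transition_Suc)
    moreover have "chase \<alpha> (Double \<nu> (i + 1)) (f i x) = transition f (Suc i) n (f i x)"
      unfolding chase_def using 2 by simp
    moreover have "chase \<alpha> (Single (s \<nu> i)) x = \<zero>\<^bsub>F\<^esub>" using 0 by (simp add: chase_def)
    ultimately show ?thesis
      using tr.hom_closed[OF f.hom_closed[OF x]] by (simp add: a_minus_def F.M.l_neg)
  next
    case never
    have "\<forall>n. s \<nu> (i + 1 + n) \<noteq> \<alpha>" using never by (metis add.assoc)
    then show ?thesis
      using never never[rule_format, of 0] by (simp add: chase_def a_minus_def F.uminus_zero)
  qed
qed

definition "collapse \<alpha> = dsum_lift F F (chase \<alpha>)"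

sublocale collapse: right_module_hom R P F "collapse \<alpha>" for \<alpha>
  unfolding P_mod_def collapse_def
  by (intro dsum_lift_hom F.right_module_axioms chase_hom)

lemma collapse_copy_at: "x \<in> carrier F \<Longrightarrow> collapse \<alpha> (copy_at F j x) = chase \<alpha> j x"
  unfolding collapse_def by (rule dsum_lift_copy_at[of R F F "chase \<alpha>" j, OF chase_hom])

text \<open>
  Below \<open>\<alpha>\<close> all the prescribed maps are \<open>0\<close>, since the ladder at \<open>\<nu> < \<alpha>\<close> stays below \<open>\<nu>\<close>.
\<close>

lemma collapse_U:
  assumes "p \<in> U \<alpha>" shows "collapse \<alpha> p = \<zero>\<^bsub>F\<^esub>"
proof -
  have "U \<alpha> \<subseteq> {p \<in> carrier P. collapse \<alpha> p = \<zero>\<^bsub>F\<^esub>}"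
  proof (intro U_minimal G_minimal collapse.kernel_submodule)
    show "P_below F \<kappa>p \<alpha> \<subseteq> {p \<in> carrier P. collapse \<alpha> p = \<zero>\<^bsub>F\<^esub>}"
    proof
      fix p assume p: "p \<in> P_below F \<kappa>p \<alpha>"
      have "collapse \<alpha> p = \<zero>\<^bsub>F\<^esub>"
        unfolding collapse_def
      proof (rule dsum_lift_zero[OF F.right_module_axioms])
        fix j assume j: "p j \<noteq> \<zero>\<^bsub>F\<^esub>"
        then have lt: "slot_ord j < \<alpha>" and slot: "j \<in> slots \<kappa>p"
          using p unfolding mem_P_below by (auto simp: P_mod_def mem_dsum_copies)
        show "chase \<alpha> j (p j) = \<zero>\<^bsub>F\<^esub>"
        proof (cases j)
          case (Single \<beta>)
          then have "\<beta> \<noteq> \<alpha>" using lt by auto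
          then show ?thesis using Single by (simp add: chase_def)
        next
          case (Double \<nu> i)
          then have "\<nu> \<in> E" using slot by (auto simp: slots_def)
          then have "s \<nu> (i + n) < \<alpha>" for n
            using ladder_less[of \<nu> "i + n"] lt Double by simp
          then have "s \<nu> (i + n) \<noteq> \<alpha>" for n by (metis less_irrefl)
          then show ?thesis using Double by (simp add: chase_def)
        qed
      qed
      then show "p \<in> {p \<in> carrier P. collapse \<alpha> p = \<zero>\<^bsub>F\<^esub>}" using p by (simp add: mem_P_below)
    qed
    fix \<nu> i x assume \<nu>: "\<nu> \<in> E" and x: "x \<in> carrier F"
    have "collapse \<alpha> (relator \<nu> i x) = \<zero>\<^bsub>F\<^esub>"
      using chase_relator[OF \<nu> x] \<nu> x copy_P Single_slot Double_slot f.hom_closed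
      by (simp add: relator_def collapse.hom_add collapse.hom_minus collapse_copy_at)
    then show "relator \<nu> i x \<in> {p \<in> carrier P. collapse \<alpha> p = \<zero>\<^bsub>F\<^esub>}" using relator_closed[OF \<nu> x] by simp
  qed
  then show ?thesis using assms by blast
qed

lemma P_below_not_subset_U:
  assumes N: "carrier N \<noteq> {\<zero>\<^bsub>N\<^esub>}" and \<alpha>\<beta>: "\<alpha> < \<beta>" "\<beta> \<le> \<kappa>p"
  shows "\<not> P_below F \<kappa>p \<beta> \<subseteq> U \<alpha>"
proof -
  have "D \<in> carrier N"
    using right_module.carrier_submodule[OF N_right_module]
      right_module.submodule_zero[OF N_right_module] by (metis direct_limit_eq zero_quot_module)
  then obtain X where "X \<in> carrier N" "X \<noteq> D"
    using N by (auto simp: direct_limit_eq zero_quot_module)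
  then obtain y where y: "y \<in> carrier S" "y \<notin> D"
    using S.coset_eq_zero_iff[OF D_submodule] by (auto simp: direct_limit_eq carrier_quot_module)
  show ?thesis
  proof (cases "\<alpha> \<in> E")
    case True
    have "unlayer \<alpha> y \<in> P_below F \<kappa>p \<beta>" by (rule unlayer_in_P_below[OF True y(1) \<alpha>\<beta>(1)])
    moreover have "unlayer \<alpha> y \<notin> U \<alpha>" using layer_U[of "unlayer \<alpha> y" \<alpha>] y(2) by (auto simp: layer_unlayer)
    ultimately show ?thesis by blast
  next
    case False
    have "\<exists>i. y i \<noteq> \<zero>\<^bsub>F\<^esub>"
      using y S.submodule_zero[OF D_submodule] by (metis dsum_copies_simps(1) ext)
    then obtain x where x: "x \<in> carrier F" "x \<noteq> \<zero>\<^bsub>F\<^esub>"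
      using F.dsum_mem_coord[OF y(1)] by blast
    have "Single \<alpha> \<in> slots \<kappa>p" using False \<alpha>\<beta> by (simp add: slots_def)
    then have "copy_at F (Single \<alpha>) x \<in> P_below F \<kappa>p \<beta>"
      using copy_P x(1) \<alpha>\<beta>(1) by (simp add: mem_P_below copy_at_def)
    moreover have "collapse \<alpha> (copy_at F (Single \<alpha>) x) \<noteq> \<zero>\<^bsub>F\<^esub>"
      using x by (simp add: collapse_copy_at chase_def)
    ultimately show ?thesis using collapse_U by blast
  qed
qed


subsection \<open>The filtration\<close>

abbreviation "MM \<equiv> M_mod R F f \<kappa>p s"
abbreviation "Msub \<equiv> M_sub R F f \<kappa>p s"

sublocale M: right_module R MM
  unfolding M_mod_def by (rule P.quot_right_module[OF G_submodule])

sublocale proj: right_module_hom R P MM "\<lambda>p. G +>\<^bsub>P\<^esub> p"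
  unfolding M_mod_def by (rule P.coset_hom[OF G_submodule])

lemma Msub_eq_image_U: "Msub \<alpha> = (\<lambda>p. G +>\<^bsub>P\<^esub> p) ` U \<alpha>"
  unfolding M_sub_def Let_def quot_module_restrict U_def by simp

lemma coset_in_Msub_iff: assumes p: "p \<in> carrier P" shows "G +>\<^bsub>P\<^esub> p \<in> Msub \<alpha> \<longleftrightarrow> p \<in> U \<alpha>"
proof
  assume "G +>\<^bsub>P\<^esub> p \<in> Msub \<alpha>"
  then obtain u where u: "u \<in> U \<alpha>" "G +>\<^bsub>P\<^esub> p = G +>\<^bsub>P\<^esub> u" unfolding Msub_eq_image_U by blast
  have uP: "u \<in> carrier P" using u(1) P.submodule_subset[OF U_submodule] by blast
  have "p \<ominus>\<^bsub>P\<^esub> u \<in> U \<alpha>"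
    using P.coset_eq_iff[OF G_submodule p uP] u(2) subsetD[OF G_subset_U] by blast
  then have "(p \<ominus>\<^bsub>P\<^esub> u) \<oplus>\<^bsub>P\<^esub> u \<in> U \<alpha>" using u(1) by (rule P.submodule_add[OF U_submodule])
  then show "p \<in> U \<alpha>" using p uP by (simp add: a_minus_def P.M.a_assoc P.M.l_neg)
qed (auto simp: Msub_eq_image_U)

lemma Msub_eq_image: "Msub \<alpha> = (\<lambda>p. G +>\<^bsub>P\<^esub> p) ` P_below F \<kappa>p \<alpha>"
proof
  show "(\<lambda>p. G +>\<^bsub>P\<^esub> p) ` P_below F \<kappa>p \<alpha> \<subseteq> Msub \<alpha>"
    unfolding Msub_eq_image_U using P_below_subset_U by (rule image_mono)
  show "Msub \<alpha> \<subseteq> (\<lambda>p. G +>\<^bsub>P\<^esub> p) ` P_below F \<kappa>p \<alpha>"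
  proof
    fix X assume "X \<in> Msub \<alpha>"
    then obtain b g where bg: "b \<in> P_below F \<kappa>p \<alpha>" "g \<in> G" "X = G +>\<^bsub>P\<^esub> (b \<oplus>\<^bsub>P\<^esub> g)"
      unfolding Msub_eq_image_U U_def set_add_def' by blast
    then have cl: "b \<in> carrier P" "g \<in> carrier P"
      using P.submodule_subset[OF G_submodule] by (auto simp: mem_P_below)
    have "(b \<oplus>\<^bsub>P\<^esub> g) \<ominus>\<^bsub>P\<^esub> b = g"
      using cl P.M.a_comm[of b g] by (simp add: a_minus_def P.M.a_assoc P.M.r_neg)
    then have "X = G +>\<^bsub>P\<^esub> b"
      using bg cl P.coset_eq_iff[OF G_submodule, of "b \<oplus>\<^bsub>P\<^esub> g" b] by simp
    then show "X \<in> (\<lambda>p. G +>\<^bsub>P\<^esub> p) ` P_below F \<kappa>p \<alpha>" using bg by blast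
  qed
qed

lemma Msub_submodule: "submodule (Msub \<alpha>) R MM"
  unfolding Msub_eq_image by (rule proj.image_submodule[OF P_below_submodule])

lemma P_below_mono: "\<alpha> \<le> \<beta> \<Longrightarrow> P_below F \<kappa>p \<alpha> \<subseteq> P_below F \<kappa>p \<beta>"
  using less_le_trans unfolding subset_iff mem_P_below by blast

lemma Msub_mono: "\<alpha> \<le> \<beta> \<Longrightarrow> Msub \<alpha> \<subseteq> Msub \<beta>"
  unfolding Msub_eq_image by (intro image_mono P_below_mono)

lemma P_below_top: "P_below F \<kappa>p \<kappa>p = carrier P"
proof -
  have "slot_ord j < \<kappa>p" if "j \<in> slots \<kappa>p" for j
    using that E_less by (auto simp: slots_def)
  then show ?thesis unfolding set_eq_iff mem_P_below P_mod_def mem_dsum_copies by blast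
qed

lemma Msub_top: "Msub \<kappa>p = carrier MM"
  unfolding Msub_eq_image P_below_top by (simp add: M_mod_def carrier_quot_module)

lemma P_below_ozero: "P_below F \<kappa>p ozero = {\<zero>\<^bsub>P\<^esub>}"
proof -
  have "\<not> \<beta> < (ozero :: 'o)" for \<beta> unfolding ozero_def using not_less_Least by blast
  then have "p = \<zero>\<^bsub>P\<^esub>" if "p \<in> P_below F \<kappa>p ozero" for p
    using that by (auto simp: mem_P_below P_simps)
  then show ?thesis using P.submodule_zero[OF P_below_submodule] by blast
qed

text \<open>
  The ordinals in the support of an element are finitely many, so their maximum and its
  successor stay below a limit ordinal.
\<close>

lemma P_below_limit:
  assumes "limit_ordinal \<alpha>" shows "P_below F \<kappa>p \<alpha> = (\<Union>\<beta><\<alpha>. P_below F \<kappa>p \<beta>)"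
proof
  show "(\<Union>\<beta><\<alpha>. P_below F \<kappa>p \<beta>) \<subseteq> P_below F \<kappa>p \<alpha>" using P_below_mono less_imp_le by blast
  show "P_below F \<kappa>p \<alpha> \<subseteq> (\<Union>\<beta><\<alpha>. P_below F \<kappa>p \<beta>)"
  proof
    fix p assume p: "p \<in> P_below F \<kappa>p \<alpha>"
    let ?A = "slot_ord ` {j. p j \<noteq> \<zero>\<^bsub>F\<^esub>}"
    have fin: "finite ?A" using p by (simp add: mem_P_below P_mod_def mem_dsum_copies)
    have lt: "\<gamma> < \<alpha>" if "\<gamma> \<in> ?A" for \<gamma> using p that by (auto simp: mem_P_below)
    have oz: "ozero < \<alpha>"
      using assms Least_le[of "\<lambda>_. True" \<alpha>] by (auto simp: limit_ordinal_def ozero_def less_le)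
    have "\<exists>\<beta><\<alpha>. \<forall>\<gamma>\<in>?A. \<gamma> < \<beta>"
    proof (cases "?A = {}")
      case True
      then show ?thesis using oz by blast
    next
      case False
      have m: "Max ?A < \<alpha>" using lt Max_in[OF fin False] by blast
      have "\<forall>\<gamma>\<in>?A. \<gamma> < osuc (Max ?A)" using Max_ge[OF fin] by (simp add: less_osuc_iff[OF m])
      then show ?thesis using assms m unfolding limit_ordinal_def by blast
    qed
    then show "p \<in> (\<Union>\<beta><\<alpha>. P_below F \<kappa>p \<beta>)" using p by (auto simp: mem_P_below)
  qed
qed

theorem Msub_strictly_increasing_filtration:
  assumes N: "carrier N \<noteq> {\<zero>\<^bsub>N\<^esub>}"
  shows "strictly_increasing_filtration R MM \<kappa>p Msub"
proof -
  have "Msub ozero = {\<zero>\<^bsub>MM\<^esub>}"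
    unfolding Msub_eq_image P_below_ozero using proj.hom_zero by simp
  moreover have "Msub \<alpha> \<subseteq> Msub (osuc \<alpha>)" if "\<alpha> < \<kappa>p" for \<alpha>
    using osuc_greater[OF that] by (intro Msub_mono) simp
  moreover have "Msub \<alpha> = (\<Union>\<beta><\<alpha>. Msub \<beta>)" if "limit_ordinal \<alpha>" for \<alpha>
    unfolding Msub_eq_image P_below_limit[OF that] by blast
  moreover have "Msub \<alpha> \<subset> Msub \<beta>" if \<alpha>\<beta>: "\<alpha> < \<beta>" "\<beta> \<le> \<kappa>p" for \<alpha> \<beta>
  proof -
    obtain p where p: "p \<in> P_below F \<kappa>p \<beta>" "p \<notin> U \<alpha>"
      using P_below_not_subset_U[OF N \<alpha>\<beta>] by blast
    then have "G +>\<^bsub>P\<^esub> p \<in> Msub \<beta>" "G +>\<^bsub>P\<^esub> p \<notin> Msub \<alpha>"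
      using coset_in_Msub_iff[of p] subsetD[OF P_below_subset_U] by (auto simp: mem_P_below)
    then show ?thesis using Msub_mono[OF less_imp_le[OF \<alpha>\<beta>(1)]] by blast
  qed
  ultimately show ?thesis
    unfolding strictly_increasing_filtration_def filtration_def
    by (intro conjI allI impI Msub_submodule Msub_top) (simp_all only:)
qed

lemma card_of_Msub:
  assumes B: "infinite B" "|{..<\<alpha>}| \<le>o |B|" "|carrier F| \<le>o |B|"
  shows "|Msub \<alpha>| \<le>o |B|"
proof -
  have "|P_below F \<kappa>p \<alpha>| \<le>o |B|"
    unfolding P_below_def
    by (intro card_of_dsum_copies card_of_slots_below B F.M.zero_closed)
  then show ?thesis unfolding Msub_eq_image using card_of_image ordLeq_transitive by blast
qed


subsection \<open>The factors of the filtration\<close>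

text \<open>
  The map \<open>M/M\<^sub>\<nu> \<rightarrow> N\<close> induced by the projection to \<open>F\<^sub>\<nu>\<close>. It is descended twice, because
  the factor is formed from \<open>M\<close>, which is itself a quotient of \<open>P\<close>.
\<close>

definition "\<theta> \<nu> = coset_lift (coset_lift (\<lambda>p. D +>\<^bsub>S\<^esub> layer \<nu> p))"

context
  fixes \<nu> assumes \<nu>: "\<nu> \<in> E"
begin

abbreviation "T \<equiv> quot_module MM (Msub \<nu>)"
abbreviation "\<pi> p \<equiv> Msub \<nu> +>\<^bsub>MM\<^esub> (G +>\<^bsub>P\<^esub> p)"

lemma layer_limit_hom: "right_module_hom R P N (\<lambda>p. D +>\<^bsub>S\<^esub> layer \<nu> p)"
proof -
  interpret c: right_module_hom R S N "\<lambda>y. D +>\<^bsub>S\<^esub> y"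
    unfolding direct_limit_eq by (rule S.coset_hom[OF D_submodule])
  show ?thesis
    by (intro right_module_hom.intro right_module_hom_axioms.intro P.right_module_axioms
        N_right_module)
      (simp add: mod_hom_def layer.hom_closed layer.hom_add layer.hom_smult c.hom_closed
        c.hom_add c.hom_smult)
qed

lemma theta_hom: "right_module_hom R T N (\<theta> \<nu>)"
  and theta_apply: "p \<in> carrier P \<Longrightarrow> \<theta> \<nu> (\<pi> p) = D +>\<^bsub>S\<^esub> layer \<nu> p"
proof -
  let ?\<phi> = "\<lambda>p. D +>\<^bsub>S\<^esub> layer \<nu> p"
  interpret l: right_module_hom R P N ?\<phi> by (rule layer_limit_hom)
  have kill: "?\<phi> u = \<zero>\<^bsub>N\<^esub>" if u: "u \<in> U \<nu>" for u
    using S.coset_eq_zero_iff[OF D_submodule layer.hom_closed] layer_U[OF u]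
      subsetD[OF P.submodule_subset[OF U_submodule] u]
    by (simp add: direct_limit_eq zero_quot_module)
  then have killG: "?\<phi> g = \<zero>\<^bsub>N\<^esub>" if "g \<in> G" for g using that G_subset_U by blast
  interpret m: right_module_hom R MM N "coset_lift ?\<phi>"
    unfolding M_mod_def by (rule l.coset_lift_hom[OF G_submodule killG])
  have m: "coset_lift ?\<phi> (G +>\<^bsub>P\<^esub> p) = ?\<phi> p" if "p \<in> carrier P" for p
    using that by (intro l.coset_lift_apply[OF G_submodule] killG)
  have killM: "coset_lift ?\<phi> X = \<zero>\<^bsub>N\<^esub>" if X: "X \<in> Msub \<nu>" for X
  proof -
    obtain u where u: "u \<in> U \<nu>" "X = G +>\<^bsub>P\<^esub> u" using X unfolding Msub_eq_image_U by blast
    then show ?thesis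
      using m[OF subsetD[OF P.submodule_subset[OF U_submodule] u(1)]] kill by simp
  qed
  show "right_module_hom R T N (\<theta> \<nu>)"
    unfolding \<theta>_def by (rule m.coset_lift_hom[OF Msub_submodule killM])
  show "\<theta> \<nu> (\<pi> p) = D +>\<^bsub>S\<^esub> layer \<nu> p" if p: "p \<in> carrier P"
  proof -
    have "coset_lift (coset_lift ?\<phi>) (\<pi> p) = coset_lift ?\<phi> (G +>\<^bsub>P\<^esub> p)"
      by (intro m.coset_lift_apply[OF Msub_submodule] killM proj.hom_closed p)
    then show ?thesis unfolding \<theta>_def m[OF p] .
  qed
qed

lemma M_factor_eq: "M_factor R F f \<kappa>p s \<mu> \<nu> = T\<lparr>carrier := \<pi> ` P_below F \<kappa>p \<mu>\<rparr>"
  unfolding M_factor_def quot_module_restrict Msub_eq_image image_image ..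

lemma pi_hom: "right_module_hom R P T \<pi>"
proof -
  interpret q: right_module_hom R MM T "\<lambda>X. Msub \<nu> +>\<^bsub>MM\<^esub> X"
    by (rule M.coset_hom[OF Msub_submodule])
  show ?thesis
    by (intro right_module_hom.intro right_module_hom_axioms.intro P.right_module_axioms
        q.B.right_module_axioms)
      (simp add: mod_hom_def proj.hom_closed proj.hom_add proj.hom_smult q.hom_closed
        q.hom_add q.hom_smult)
qed

lemma theta_bij: "bij_betw (\<theta> \<nu>) (\<pi> ` P_below F \<kappa>p (osuc \<nu>)) (carrier N)"
proof -
  interpret pi: right_module_hom R P T \<pi> by (rule pi_hom)
  interpret th: right_module_hom R T N "\<theta> \<nu>" by (rule theta_hom)
  let ?B = "P_below F \<kappa>p (osuc \<nu>)"
  have BP: "?B \<subseteq> carrier P" by (rule P.submodule_subset[OF P_below_submodule])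
  have "\<theta> \<nu> ` \<pi> ` ?B = carrier N"
  proof
    show "\<theta> \<nu> ` \<pi> ` ?B \<subseteq> carrier N" using BP pi.hom_closed th.hom_closed by blast
    show "carrier N \<subseteq> \<theta> \<nu> ` \<pi> ` ?B"
    proof
      fix X assume "X \<in> carrier N"
      then obtain y where y: "y \<in> carrier S" "X = D +>\<^bsub>S\<^esub> y"
        by (auto simp: direct_limit_eq carrier_quot_module)
      have u: "unlayer \<nu> y \<in> ?B"
        using unlayer_in_P_below[OF \<nu> y(1) osuc_greater[OF E_less[OF \<nu>]]] .
      then have "X = \<theta> \<nu> (\<pi> (unlayer \<nu> y))" using theta_apply BP y(2) by (auto simp: layer_unlayer)
      then show "X \<in> \<theta> \<nu> ` \<pi> ` ?B" using u by blast
    qed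
  qed
  moreover have "inj_on (\<theta> \<nu>) (\<pi> ` ?B)"
  proof (rule inj_onI)
    fix X Y assume X: "X \<in> \<pi> ` ?B" and Y: "Y \<in> \<pi> ` ?B" and eq: "\<theta> \<nu> X = \<theta> \<nu> Y"
    obtain p q where p: "p \<in> ?B" "X = \<pi> p" and q: "q \<in> ?B" "Y = \<pi> q" using X Y by blast
    have cl: "p \<in> carrier P" "q \<in> carrier P" using p q BP by auto
    have d: "p \<ominus>\<^bsub>P\<^esub> q \<in> ?B" using p(1) q(1) by (rule P.submodule_minus[OF P_below_submodule])
    have "layer \<nu> p \<ominus>\<^bsub>S\<^esub> layer \<nu> q \<in> D"
      using eq S.coset_eq_iff[OF D_submodule] cl layer.hom_closed by (simp add: p q theta_apply)
    then have "layer \<nu> (p \<ominus>\<^bsub>P\<^esub> q) \<in> D" using cl by (simp add: layer.hom_minus)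
    then have "p \<ominus>\<^bsub>P\<^esub> q \<in> U \<nu>" using mem_U_if_layer[OF \<nu> d] by blast
    then have "G +>\<^bsub>P\<^esub> (p \<ominus>\<^bsub>P\<^esub> q) \<in> Msub \<nu>" using cl by (simp add: coset_in_Msub_iff)
    then have "(G +>\<^bsub>P\<^esub> p) \<ominus>\<^bsub>MM\<^esub> (G +>\<^bsub>P\<^esub> q) \<in> Msub \<nu>" using cl by (simp add: proj.hom_minus)
    then show "X = Y"
      unfolding p q using M.coset_eq_iff[OF Msub_submodule] proj.hom_closed cl by blast
  qed
  ultimately show ?thesis unfolding bij_betw_def by blast
qed

text \<open>
  The map \<open>\<theta>\<close> restricted to \<open>M\<^sub>\<mu>/M\<^sub>\<nu>\<close> is still bijective on \<open>M\<^bsub>\<nu>+1\<^esub>/M\<^sub>\<nu>\<close>, so its kernel is a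
  complement.
\<close>

theorem M_factor_splits:
  assumes \<nu>\<mu>: "\<nu> < \<mu>"
  shows "\<exists>K. internal_direct_sum R (M_factor R F f \<kappa>p s \<mu> \<nu>)
    (carrier (M_factor R F f \<kappa>p s (osuc \<nu>) \<nu>)) K"
proof -
  interpret pi: right_module_hom R P T \<pi> by (rule pi_hom)
  interpret th: right_module_hom R T N "\<theta> \<nu>" by (rule theta_hom)
  let ?C = "\<pi> ` P_below F \<kappa>p (osuc \<nu>)" and ?A = "\<pi> ` P_below F \<kappa>p \<mu>"
  have A: "submodule ?A R T" and C: "submodule ?C R T"
    by (rule pi.image_submodule[OF P_below_submodule])+
  interpret r: right_module_hom R "T\<lparr>carrier := ?A\<rparr>" N "\<theta> \<nu>" by (rule th.restrict_hom[OF A])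
  have "?C \<subseteq> ?A" using osuc_le[OF \<nu>\<mu>] by (intro image_mono P_below_mono)
  then have "submodule ?C R (T\<lparr>carrier := ?A\<rparr>)" by (rule pi.B.submodule_of_submodule[OF C A])
  then have "internal_direct_sum R (T\<lparr>carrier := ?A\<rparr>) ?C
      {x \<in> carrier (T\<lparr>carrier := ?A\<rparr>). \<theta> \<nu> x = \<zero>\<^bsub>N\<^esub>}"
    using theta_bij by (rule r.direct_sum_kernel)
  then show ?thesis unfolding M_factor_eq by auto
qed

theorem M_factor_iso_limit: "mod_isomorphic R (M_factor R F f \<kappa>p s (osuc \<nu>) \<nu>) N"
proof -
  interpret pi: right_module_hom R P T \<pi> by (rule pi_hom)
  interpret th: right_module_hom R T N "\<theta> \<nu>" by (rule theta_hom)
  interpret r: right_module_hom R "T\<lparr>carrier := \<pi> ` P_below F \<kappa>p (osuc \<nu>)\<rparr>" N "\<theta> \<nu>"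
    by (rule th.restrict_hom[OF pi.image_submodule[OF P_below_submodule]])
  show ?thesis unfolding mod_isomorphic_def M_factor_eq using r.hom theta_bij by auto
qed

end

end

theorem proposition5p5:
  fixes R :: "('r, 'x) ring_scheme" and F :: "('r, 'f, 'y) module_scheme"
    and f :: "nat \<Rightarrow> 'f \<Rightarrow> 'f"
    and \<kappa> \<kappa>p :: "'o::wellorder" and s :: "'o \<Rightarrow> nat \<Rightarrow> 'o"
  assumes "ring R"
    and "right_module R F"
    and "\<And>i. f i \<in> mod_hom R F F"
    and "carrier (direct_limit R F f) \<noteq> {\<zero>\<^bsub>direct_limit R F f\<^esub>}"
    and "infinite_cardinal \<kappa>"
    and "successor_cardinal \<kappa> \<kappa>p"
    and "ladder_system \<kappa>p s"
  shows
    "strictly_increasing_filtration R (M_mod R F f \<kappa>p s) \<kappa>p (M_sub R F f \<kappa>p s)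
     \<and>
     ( |carrier F| \<le>o |{..<\<kappa>}| \<and> |carrier R| \<le>o |{..<\<kappa>}| \<longrightarrow>
        (\<forall>\<alpha><\<kappa>p.
           lt_generated R \<kappa>p ((M_mod R F f \<kappa>p s)\<lparr>carrier := M_sub R F f \<kappa>p s \<alpha>\<rparr>)
           \<and> lt_presented R \<kappa>p ((M_mod R F f \<kappa>p s)\<lparr>carrier := M_sub R F f \<kappa>p s \<alpha>\<rparr>))
        \<and> le_generated R \<kappa>p (M_mod R F f \<kappa>p s))
     \<and>
     (\<forall>\<nu> \<mu>. \<nu> \<in> cof_omega \<kappa>p \<and> \<nu> < \<mu> \<and> \<mu> \<le> \<kappa>p \<longrightarrow>
        (\<exists>K. internal_direct_sum R (M_factor R F f \<kappa>p s \<mu> \<nu>)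
               (carrier (M_factor R F f \<kappa>p s (osuc \<nu>) \<nu>)) K)
        \<and> mod_isomorphic R (M_factor R F f \<kappa>p s (osuc \<nu>) \<nu>) (direct_limit R F f))"
proof -
  interpret ladder_construction R F f \<kappa>p s
    using assms by (intro ladder_construction.intro ladder_construction_axioms.intro)
  have inf: "infinite {..<\<kappa>}" using assms(5) by (simp add: infinite_cardinal_def)
  note card = card_below_successor_cardinal[OF assms(6)]
  have small: "lt_generated R \<kappa>p (MM\<lparr>carrier := Msub \<alpha>\<rparr>)"
      "lt_presented R \<kappa>p (MM\<lparr>carrier := Msub \<alpha>\<rparr>)"
    if \<alpha>: "\<alpha> < \<kappa>p" and cF: "|carrier F| \<le>o |{..<\<kappa>}|" and cR: "|carrier R| \<le>o |{..<\<kappa>}|" for \<alpha>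
  proof -
    interpret A: right_module R "MM\<lparr>carrier := Msub \<alpha>\<rparr>"
      by (rule M.submodule_right_module[OF Msub_submodule])
    have c: "|carrier (MM\<lparr>carrier := Msub \<alpha>\<rparr>)| \<le>o |{..<\<kappa>}|"
      using card_of_Msub[OF inf card(2)[OF \<alpha>] cF] by simp
    show "lt_generated R \<kappa>p (MM\<lparr>carrier := Msub \<alpha>\<rparr>)"
      using ordLeq_ordLess_trans[OF c card(1)] by (rule A.lt_generated_if_small)
    show "lt_presented R \<kappa>p (MM\<lparr>carrier := Msub \<alpha>\<rparr>)"
      using inf card(1) cR c by (rule A.lt_presented_if_small)
  qed
  have large: "le_generated R \<kappa>p MM" if cF: "|carrier F| \<le>o |{..<\<kappa>}|"
  proof (rule M.le_generated_if_small)
    have le: "|{..<\<kappa>}| \<le>o |{..<\<kappa>p}|" using card(1) by (rule ordLess_imp_ordLeq)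
    have "infinite {..<\<kappa>p}" using card_of_ordLeq_infinite[OF le inf] .
    then have "|Msub \<kappa>p| \<le>o |{..<\<kappa>p}|"
      using ordLeq_transitive[OF cF le] by (intro card_of_Msub ordLeq_refl card_of_Card_order)
    then show "|carrier MM| \<le>o |{..<\<kappa>p}|" by (simp only: Msub_top)
  qed
  show ?thesis
    by (intro conjI allI impI Msub_strictly_increasing_filtration[OF assms(4)])
      (use small large M_factor_splits M_factor_iso_limit in blast)+
qed

end
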